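(* Let $(p_i)_{i\in\mathbb{I}}$ be a probability distribution on $\mathbb{I}$, not depending on $n$, with $p_i<1$ for all $i\in\mathbb{I}$. For each $n\ge1$ let $G=(G_1,\dots,G_n)$ be i.i.d. with $\mathbb{P}(G_j=i)=p_i$. Fix $k\ge1$. Then, as $n\to+\infty$, the random family $(D_{\mathbf{i}})_{\mathbf{i}\in\widetilde{Q}_l,\,l\le k}$ associated with $\mathrm{std}(G)$ converges in distribution, in the space $\ell^1\left(\bigcup_{l\le k}\widetilde{Q}_l\right)$, to the product distribution $$\bigotimes_{\mathbf{i}\in\widetilde{Q}_l,\,l\le k}\mathrm{Geo}_0(1-p_{\mathbf{i}}).$$
   Context: $\mathbb{I}\subset\mathbb{R}$ is a countable set. For $g=(g_1,\dots,g_n)\in\mathbb{R}^n$, the standardized permutation $\sigma=\mathrm{std}(g)\in\mathfrak{S}_n$ is defined by: $\sigma(j)<\sigma(k)$ if and only if $g_j<g_k$, or $g_j=g_k$ and $j<k$. A word $\mathbf{i}\in\mathbb{I}^k$ is a (nontrivial) power if $\mathbf{i}=y^l$ for some word $y$ and integer $l\ge2$; it is primitive if it is not a power. $Q_k$ is the set of primitive words of length $k$ over $\mathbb{I}$. Two words are conjugate if one is a cyclic shift of the other; $\widetilde{Q}_k$ is the set of conjugacy classes of words of $Q_k$. Write $p_{\mathbf{i}}=p_{i_1}\cdots p_{i_k}$ (this depends only on the conjugacy class). For $\mathbf{i}\in\widetilde{Q}_k$ represented by $(i_1,\dots,i_k)$, $D_{\mathbf{i}}$ is the number of cycles of length $k$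 of $\mathrm{std}(G)$ that can be written $(x_1,\dots,x_k)$ (meaning $x_1\mapsto x_2\mapsto\cdots\mapsto x_k\mapsto x_1$) with $G_{x_1}=i_1,\dots,G_{x_k}=i_k$; this does not depend on the representative. $\mathrm{Geo}_0(p)$ is the geometric distribution on $\{0,1,2,\dots\}$: $\mathbb{P}(X=j)=(1-p)^jp$. *)

theory Defs
  imports "HOL-Probability.Probability" "HOL-Combinatorics.Permutations"
begin

section \<open>Standardized permutations and their cycles\<close>

text \<open>Vectors \<open>(g\<^sub>1, \<dots>, g\<^sub>n)\<close> are functions on \<open>nat\<close> of which only the values on
  \<open>{1..n}\<close> matter; permutations of \<open>{1..n}\<close> fix all other naturals.\<close>

definition is_std :: "nat \<Rightarrow> (nat \<Rightarrow> real) \<Rightarrow> (nat \<Rightarrow> nat) \<Rightarrow> bool" where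
  "is_std n g \<sigma> \<longleftrightarrow> \<sigma> permutes {1..n} \<and>
     (\<forall>j\<in>{1..n}. \<forall>k\<in>{1..n}. \<sigma> j < \<sigma> k \<longleftrightarrow> g j < g k \<or> (g j = g k \<and> j < k))"

definition std :: "nat \<Rightarrow> (nat \<Rightarrow> real) \<Rightarrow> nat \<Rightarrow> nat" where
  "std n g = (THE \<sigma>. is_std n g \<sigma>)"

lemma is_std_rank:
  assumes "is_std n g \<sigma>" "j \<in> {1..n}"
  shows "\<sigma> j = card {i\<in>{1..n}. g i < g j \<or> (g i = g j \<and> i \<le> j)}"
proof -
  have perm: "\<sigma> permutes {1..n}" using assms(1) by (simp add: is_std_def)
  have eq: "{i\<in>{1..n}. g i < g j \<or> (g i = g j \<and> i \<le> j)} = {i\<in>{1..n}. \<sigma> i \<le> \<sigma> j}"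
  proof (rule Collect_cong, rule conj_cong, rule refl)
    fix i assume i: "i \<in> {1..n}"
    have "\<sigma> j < \<sigma> i \<longleftrightarrow> g j < g i \<or> (g j = g i \<and> j < i)"
      using assms(1) assms(2) i by (simp add: is_std_def)
    then show "(g i < g j \<or> (g i = g j \<and> i \<le> j)) \<longleftrightarrow> \<sigma> i \<le> \<sigma> j" by linarith
  qed
  have sj: "\<sigma> j \<in> {1..n}" using assms(2) by (simp only: permutes_in_image[OF perm])
  have "\<sigma> ` {i\<in>{1..n}. \<sigma> i \<le> \<sigma> j} = {m \<in> \<sigma> ` {1..n}. m \<le> \<sigma> j}" by blast
  also have "\<dots> = {1..\<sigma> j}" using sj by (subst permutes_image[OF perm]) auto
  finally have "card (\<sigma> ` {i\<in>{1..n}. \<sigma> i \<le> \<sigma> j}) = \<sigma> j" by simp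
  moreover have "card (\<sigma> ` {i\<in>{1..n}. \<sigma> i \<le> \<sigma> j}) = card {i\<in>{1..n}. \<sigma> i \<le> \<sigma> j}"
    by (rule card_image) (rule inj_on_subset[OF permutes_inj[OF perm]], simp)
  ultimately show ?thesis unfolding eq by simp
qed

lemma is_std_ex: "\<exists>\<sigma>. is_std n g \<sigma>"
proof -
  define A where "A j = {i\<in>{1..n}. g i < g j \<or> (g i = g j \<and> i \<le> j)}" for j
  define \<sigma> where "\<sigma> j = (if j \<in> {1..n} then card (A j) else j)" for j
  have finA: "finite (A j)" for j unfolding A_def by simp
  have less: "card (A j) < card (A k)"
    if "j \<in> {1..n}" "k \<in> {1..n}" "g j < g k \<or> (g j = g k \<and> j < k)" for j k
  proof (rule psubset_card_mono[OF finA])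
    have "A j \<subseteq> A k" using that unfolding A_def by auto
    moreover have "k \<in> A k" "k \<notin> A j" using that unfolding A_def by auto
    ultimately show "A j \<subset> A k" by blast
  qed
  have iff: "\<sigma> j < \<sigma> k \<longleftrightarrow> g j < g k \<or> (g j = g k \<and> j < k)"
    if "j \<in> {1..n}" "k \<in> {1..n}" for j k
  proof
    assume "g j < g k \<or> (g j = g k \<and> j < k)"
    then show "\<sigma> j < \<sigma> k" using less[OF that] that unfolding \<sigma>_def by simp
  next
    assume lt: "\<sigma> j < \<sigma> k"
    show "g j < g k \<or> (g j = g k \<and> j < k)"
    proof (rule ccontr)
      assume "\<not> ?thesis"
      then consider "j = k" | "g k < g j \<or> (g k = g j \<and> k < j)" by force
      then show False
      proof cases
        case 1
        then show False using lt by simp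
      next
        case 2
        have "card (A j) < card (A k)" using lt that by (simp add: \<sigma>_def)
        then show False using less[OF that(2,1) 2] by simp
      qed
    qed
  qed
  have inj: "inj_on \<sigma> {1..n}"
  proof (rule inj_onI)
    fix j k assume jk: "j \<in> {1..n}" "k \<in> {1..n}" "\<sigma> j = \<sigma> k"
    have "\<not> \<sigma> j < \<sigma> k" "\<not> \<sigma> k < \<sigma> j" using jk(3) by simp_all
    then have "\<not> (g j < g k \<or> (g j = g k \<and> j < k))" "\<not> (g k < g j \<or> (g k = g j \<and> k < j))"
      unfolding iff[OF jk(1,2)] iff[OF jk(2,1)] .
    then show "j = k" by auto
  qed
  have "\<sigma> ` {1..n} \<subseteq> {1..n}"
  proof
    fix m assume "m \<in> \<sigma> ` {1..n}"
    then obtain j where j: "j \<in> {1..n}" "m = \<sigma> j" by blast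
    then have m: "m = card (A j)" by (simp add: \<sigma>_def)
    have "card (A j) \<le> card {1..n}" by (rule card_mono) (auto simp: A_def)
    moreover have "j \<in> A j" using j unfolding A_def by simp
    then have "card (A j) > 0" using finA[of j] card_gt_0_iff by blast
    ultimately show "m \<in> {1..n}" using m by simp
  qed
  then have "bij_betw \<sigma> {1..n} {1..n}"
    using inj by (simp add: bij_betw_def endo_inj_surj)
  moreover have "\<sigma> j = j" if "j \<notin> {1..n}" for j
    unfolding \<sigma>_def using that by (rule if_not_P)
  ultimately have "\<sigma> permutes {1..n}" by (rule bij_imp_permutes)
  with iff show ?thesis unfolding is_std_def by blast
qed

lemma is_std_unique:
  assumes "is_std n g \<sigma>" "is_std n g \<tau>"
  shows "\<sigma> = \<tau>"
proof
  fix j show "\<sigma> j = \<tau> j"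
  proof (cases "j \<in> {1..n}")
    case True
    show ?thesis
      unfolding is_std_rank[OF assms(1) True] is_std_rank[OF assms(2) True] ..
  next
    case False
    have "\<sigma> permutes {1..n}" "\<tau> permutes {1..n}" using assms by (simp_all add: is_std_def)
    then show ?thesis using permutes_not_in[OF _ False] by metis
  qed
qed

lemma is_std_std: "is_std n g (std n g)"
proof -
  obtain \<sigma> where \<sigma>: "is_std n g \<sigma>" using is_std_ex by blast
  show ?thesis unfolding std_def by (rule theI[where a = \<sigma>]) (use \<sigma> is_std_unique in blast)+
qed

text \<open>\<open>map \<sigma> xs = rotate1 xs\<close> says \<open>x\<^sub>1 \<mapsto> x\<^sub>2 \<mapsto> \<dots> \<mapsto> x\<^sub>k \<mapsto> x\<^sub>1\<close>.\<close>

definition writes_cycle :: "nat \<Rightarrow> (nat \<Rightarrow> nat) \<Rightarrow> nat list \<Rightarrow> bool" where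
  "writes_cycle n \<sigma> xs \<longleftrightarrow>
     xs \<noteq> [] \<and> distinct xs \<and> set xs \<subseteq> {1..n} \<and> map \<sigma> xs = rotate1 xs"


section \<open>Primitive words and their conjugacy classes\<close>

definition nontrivial_power :: "'a list \<Rightarrow> bool" where
  "nontrivial_power w \<longleftrightarrow> (\<exists>y l. l \<ge> 2 \<and> w = concat (replicate l y))"

definition primitive_words :: "'a set \<Rightarrow> nat \<Rightarrow> 'a list set" where
  "primitive_words I k = {w. set w \<subseteq> I \<and> length w = k \<and> \<not> nontrivial_power w}"

definition conj_words :: "('a list \<times> 'a list) set" where
  "conj_words = {(v, w). \<exists>m. w = rotate m v}"

definition primitive_classes :: "'a set \<Rightarrow> nat \<Rightarrow> 'a list set set" where
  "primitive_classes I k = primitive_words I k // conj_words"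

definition primitive_classes_upto :: "'a set \<Rightarrow> nat \<Rightarrow> 'a list set set" where
  "primitive_classes_upto I k = (\<Union>l\<in>{1..k}. primitive_classes I l)"

lemma equiv_conj_words: "equiv UNIV (conj_words :: ('a list \<times> 'a list) set)"
proof (rule equivI)
  show "refl (conj_words :: ('a list \<times> 'a list) set)"
    by (rule refl_onI) (auto simp: conj_words_def intro: exI[of _ 0])
  show "sym (conj_words :: ('a list \<times> 'a list) set)"
  proof (rule symI)
    fix v w :: "'a list" assume "(v, w) \<in> conj_words"
    then obtain m where m: "w = rotate m v" by (auto simp: conj_words_def)
    have "rotate (length v - m mod length v) w = v"
    proof (cases "v = []")
      case False
      then have "m mod length v < length v" by simp
      moreover have "w = rotate (m mod length v) v" using m rotate_conv_mod by metis
      ultimately show ?thesis by (simp add: rotate_rotate)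
    qed (simp add: m)
    from this[symmetric] have "\<exists>m'. v = rotate m' w" by (rule exI)
    then show "(w, v) \<in> conj_words" by (simp add: conj_words_def)
  qed
  show "trans (conj_words :: ('a list \<times> 'a list) set)"
    by (rule transI) (auto simp: conj_words_def rotate_rotate)
qed simp

definition rep :: "'a list set \<Rightarrow> 'a list" where
  "rep c = (SOME w. w \<in> c)"

definition word_weight :: "('a \<Rightarrow> real) \<Rightarrow> 'a list \<Rightarrow> real" where
  "word_weight p w = prod_list (map p w)"

text \<open>Distinct cycles of a permutation have disjoint supports, so a cycle is identified
  with its support \<open>set xs\<close>. This way each cycle is counted once, irrespective of the number
  of ways to write it. Its length is that of \<open>w\<close>.\<close>

definition cycle_count :: "nat \<Rightarrow> (nat \<Rightarrow> real) \<Rightarrow> real list \<Rightarrow> nat" where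
  "cycle_count n g w = card {set xs | xs. writes_cycle n (std n g) xs \<and> map g xs = w}"

lemma word_weight_rotate: "word_weight p (rotate m w) = word_weight p w"
proof -
  have "prod_list (map p (rotate m w)) = prod_list (map p (drop (m mod length w) w)) *
      prod_list (map p (take (m mod length w) w))"
    by (simp add: rotate_drop_take)
  also have "\<dots> = prod_list (map p (take (m mod length w) w @ drop (m mod length w) w))"
    by (simp only: map_append prod_list.append mult.commute)
  finally show ?thesis unfolding word_weight_def by (simp only: append_take_drop_id)
qed

lemma writes_cycle_rotate:
  assumes "writes_cycle n \<sigma> xs"
  shows "writes_cycle n \<sigma> (rotate m xs)"
proof -
  have "map \<sigma> (rotate m xs) = rotate m (map \<sigma> xs)" by (rule rotate_map[symmetric])
  also have "\<dots> = rotate m (rotate1 xs)" using assms by (simp add: writes_cycle_def)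
  also have "\<dots> = rotate1 (rotate m xs)" by (rule rotate1_rotate_swap[symmetric])
  finally show ?thesis using assms unfolding writes_cycle_def by simp
qed

lemma cycle_count_rotate_aux:
  "{set xs | xs. writes_cycle n (std n g) xs \<and> map g xs = w}
     \<subseteq> {set xs | xs. writes_cycle n (std n g) xs \<and> map g xs = rotate m w}"
proof safe
  fix xs assume "writes_cycle n (std n g) xs" "w = map g xs"
  then show "\<exists>ys. set xs = set ys \<and> writes_cycle n (std n g) ys \<and> map g ys = rotate m (map g xs)"
    by (intro exI[of _ "rotate m xs"]) (simp add: writes_cycle_rotate rotate_map)
qed

lemma cycle_count_conj:
  assumes "(v, w) \<in> conj_words"
  shows "cycle_count n g v = cycle_count n g w"
proof -
  obtain m where m: "w = rotate m v" using assms by (auto simp: conj_words_def)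
  have "(w, v) \<in> conj_words"
    using equiv_conj_words assms unfolding equiv_def by (blast dest: symD)
  then obtain m' where m': "v = rotate m' w" by (auto simp: conj_words_def)
  show ?thesis unfolding cycle_count_def
    using cycle_count_rotate_aux[of n g v m, folded m]
      cycle_count_rotate_aux[of n g w m', folded m']
    by (intro arg_cong[where f = card] subset_antisym)
qed

lemma rep_conj:
  assumes "c \<in> primitive_classes I k" "w \<in> c"
  shows "(rep c, w) \<in> conj_words"
proof -
  have "rep c \<in> c" unfolding rep_def using assms(2) by (rule someI)
  moreover have "c \<in> UNIV // conj_words"
    using assms(1) unfolding primitive_classes_def quotient_def by blast
  ultimately show ?thesis
    using assms(2) quotient_eq_iff[OF equiv_conj_words, of c c "rep c" w] by simp
qed

lemma cycle_count_rep:
  "c \<in> primitive_classes I k \<Longrightarrow> w \<in> c \<Longrightarrow> cycle_count n g (rep c) = cycle_count n g w"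
  by (rule cycle_count_conj[OF rep_conj])

lemma word_weight_rep:
  assumes "c \<in> primitive_classes I k" "w \<in> c"
  shows "word_weight p (rep c) = word_weight p w"
proof -
  obtain m where "w = rotate m (rep c)"
    using rep_conj[OF assms] unfolding conj_words_def by blast
  then show ?thesis using word_weight_rotate[of p m "rep c"] by simp
qed


section \<open>The metric space \<open>\<ell>\<^sup>1(S)\<close>\<close>

definition ell1 :: "'a set \<Rightarrow> ('a \<Rightarrow> real) set" where
  "ell1 S = {x \<in> extensional S. (\<lambda>i. \<bar>x i\<bar>) summable_on S}"

definition ell1_dist :: "'a set \<Rightarrow> ('a \<Rightarrow> real) \<Rightarrow> ('a \<Rightarrow> real) \<Rightarrow> real" where
  "ell1_dist S x y = (\<Sum>\<^sub>\<infinity>i\<in>S. \<bar>x i - y i\<bar>)"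

definition ell1_topology :: "'a set \<Rightarrow> ('a \<Rightarrow> real) topology" where
  "ell1_topology S = Metric_space.mtopology (ell1 S) (ell1_dist S)"

lemma ell1_diff_summable:
  assumes "x \<in> ell1 S" "y \<in> ell1 S"
  shows "(\<lambda>i. \<bar>x i - y i\<bar>) summable_on S"
proof (rule summable_on_comparison_test)
  show "(\<lambda>i. \<bar>x i\<bar> + \<bar>y i\<bar>) summable_on S"
    using assms by (intro summable_on_add) (auto simp: ell1_def)
qed auto

lemma Metric_space_ell1: "Metric_space (ell1 S) (ell1_dist S)"
proof
  fix x y :: "'a \<Rightarrow> real"
  show "0 \<le> ell1_dist S x y" unfolding ell1_dist_def by (rule infsum_nonneg) simp
  show "ell1_dist S x y = ell1_dist S y x"
    unfolding ell1_dist_def by (simp add: abs_minus_commute)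
next
  fix x y :: "'a \<Rightarrow> real" assume xy: "x \<in> ell1 S" "y \<in> ell1 S"
  show "ell1_dist S x y = 0 \<longleftrightarrow> x = y"
  proof
    assume 0: "ell1_dist S x y = 0"
    have "\<bar>x i - y i\<bar> = 0" if "i \<in> S" for i
      by (rule nonneg_infsum_le_0D[OF _ ell1_diff_summable[OF xy] _ that])
        (use 0 in \<open>simp_all add: ell1_dist_def\<close>)
    then show "x = y" using xy by (intro extensionalityI[of _ S]) (auto simp: ell1_def)
  qed (simp add: ell1_dist_def)
next
  fix x y z :: "'a \<Rightarrow> real" assume xyz: "x \<in> ell1 S" "y \<in> ell1 S" "z \<in> ell1 S"
  have "ell1_dist S x z \<le> (\<Sum>\<^sub>\<infinity>i\<in>S. \<bar>x i - y i\<bar> + \<bar>y i - z i\<bar>)"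
    unfolding ell1_dist_def
    using xyz by (intro infsum_mono summable_on_add ell1_diff_summable) auto
  also have "\<dots> = ell1_dist S x y + ell1_dist S y z"
    unfolding ell1_dist_def using xyz by (intro infsum_add ell1_diff_summable)
  finally show "ell1_dist S x z \<le> ell1_dist S x y + ell1_dist S y z" .
qed

lemma topspace_ell1 [simp]: "topspace (ell1_topology S) = ell1 S"
  unfolding ell1_topology_def
  by (rule Metric_space.topspace_mtopology[OF Metric_space_ell1])


section \<open>Convergence in distribution\<close>

definition borel_of_topology :: "'a topology \<Rightarrow> 'a measure" where
  "borel_of_topology X = sigma (topspace X) {U. openin X U}"

text \<open>Sequences are indexed by \<open>n \<ge> 1\<close>, each random variable \<open>Y n\<close> living on its own
  probability space \<open>M n\<close>. That the \<open>Y n\<close> are Borel random elements of the space and that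
  the limit law \<open>\<nu>\<close> is a Borel probability measure on it is part of the assertion.\<close>

definition converges_in_distribution ::
    "'b topology \<Rightarrow> (nat \<Rightarrow> 'a measure) \<Rightarrow> (nat \<Rightarrow> 'a \<Rightarrow> 'b) \<Rightarrow> 'b measure \<Rightarrow> bool" where
  "converges_in_distribution X M Y \<nu> \<longleftrightarrow>
     (\<forall>n\<ge>1. prob_space (M n) \<and> Y n \<in> measurable (M n) (borel_of_topology X)) \<and>
     prob_space \<nu> \<and> space \<nu> = topspace X \<and> sets \<nu> = sets (borel_of_topology X) \<and>
     (\<forall>f. continuous_map X euclideanreal f \<and> bounded (f ` topspace X) \<longrightarrow>
        (\<lambda>n. \<integral>\<omega>. f (Y n \<omega>) \<partial>M n) \<longlonglongrightarrow> (\<integral>x. f x \<partial>\<nu>))"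


section \<open>The random family and its limit law\<close>

definition cycle_family ::
    "real set \<Rightarrow> nat \<Rightarrow> nat \<Rightarrow> (nat \<Rightarrow> real) \<Rightarrow> real list set \<Rightarrow> real" where
  "cycle_family I k n g =
     (\<lambda>c\<in>primitive_classes_upto I k. real (cycle_count n g (rep c)))"

definition product_geometric ::
    "real set \<Rightarrow> (real \<Rightarrow> real) \<Rightarrow> nat \<Rightarrow> (real list set \<Rightarrow> real) measure" where
  "product_geometric I p k =
     PiM (primitive_classes_upto I k)
       (\<lambda>c. distr (measure_pmf (geometric_pmf (1 - word_weight p (rep c)))) borel real)"

text \<open>The product measure viewed as a measure on its measurable subset \<open>\<ell>\<^sup>1\<close>. It is a
  probability measure there iff the product measure gives full mass to \<open>\<ell>\<^sup>1\<close>.\<close>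

definition product_geometric_ell1 ::
    "real set \<Rightarrow> (real \<Rightarrow> real) \<Rightarrow> nat \<Rightarrow> (real list set \<Rightarrow> real) measure" where
  "product_geometric_ell1 I p k =
     restrict_space (product_geometric I p k) (ell1 (primitive_classes_upto I k))"

end

theory Submission
  imports Defs "HOL-Combinatorics.Cycles" "HOL-Library.List_Lexorder"
begin

text \<open>To a point \<open>y\<close> attach its itinerary, the periodic infinite word \<open>g y, g (\<sigma> y), g (\<sigma>\<^sup>2 y), \<dots>\<close>
  with \<open>\<sigma> = std n g\<close>. By a form of the Gessel--Reutenauer bijection, \<open>g\<close> is determined by the
  multiset of its itineraries, and every finite shift-invariant multiset of periodic words of total
  size \<open>n\<close> arises in this way. A primitive word \<open>w\<close> labels as many cycles as there are points with
  itinerary \<open>w w w \<dots>\<close>. Hence adding prescribed cycles is a bijection onto the words containing them,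
  and it multiplies probabilities by the weights of these cycles. So, for finitely many classes and
  \<open>n\<close> large, \<open>D c \<ge> m c\<close> holds jointly with probability exactly \<open>\<Prod>c. p c ^ m c\<close>, the tail of the product of
  geometric laws. As \<open>\<Sum>c. p c\<close> is finite, with probability close to 1 no class outside a large finite
  set occurs, uniformly in \<open>n\<close>. So the point masses converge to those of the limit law,
  which is carried by the countable set of finitely supported families, and the convergence even
  holds in total variation.\<close>

section \<open>Itineraries of a standardized permutation\<close>

text \<open>A finitely supported, shift-invariant function on infinite words stands for the multiset
  of cycle words. Putting cycles together is then addition of functions, and primitive roots and
  conjugacy do not enter before cycles are counted. The tails are exact for one reason: the words of
  length \<open>n\<close> that contain the prescribed cycles are the images of all words of length
  \<open>n - s\<close>, where \<open>s\<close> is the number of points on these cycles, and the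
  weights of the latter sum to 1.

  When \<open>I\<close> is infinite there are infinitely many classes, and convergence of finitely
  many coordinates does not keep mass from escaping. The exact probability of a single class, valid
  as soon as \<open>n\<close> exceeds \<open>k\<close>, gives a union bound outside a finite set of
  classes that is the same for all these \<open>n\<close> and for the limit. The topology of
  \<open>ell1\<close> matters only through its Borel sets: the limit law is built as a product
  measure, so the Borel sets have to be identified with the trace of the product
  sigma-algebra.\<close>

lemma std_permutes: "std n g permutes {1..n}"
  using is_std_std[of n g] by (simp add: is_std_def)

lemma std_less_iff:
  "j \<in> {1..n} \<Longrightarrow> k \<in> {1..n} \<Longrightarrow> std n g j < std n g k \<longleftrightarrow> g j < g k \<or> (g j = g k \<and> j < k)"
  using is_std_std[of n g] by (simp add: is_std_def)

lemma std_cong: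
  assumes "\<And>j. j \<in> {1..n} \<Longrightarrow> g j = h j"
  shows "std n g = std n h"
proof -
  have "is_std n h (std n g)"
    using is_std_std[of n g] assms by (simp add: is_std_def)
  then show ?thesis using is_std_std is_std_unique by blast
qed

lemma funpow_std_in: "(std n g ^^ k) y \<in> {1..n} \<longleftrightarrow> y \<in> {1..n}"
  by (rule permutes_in_image[OF permutes_funpow[OF std_permutes]])

lemma funpow_permutes_eq_id:
  assumes "f permutes A" "finite A"
  obtains N where "N > 0" "f ^^ N = id"
  using permutation_is_nilpotent[OF permutes_imp_permutation[OF assms(2,1)]] that by blast

definition itinerary :: "nat \<Rightarrow> (nat \<Rightarrow> real) \<Rightarrow> nat \<Rightarrow> nat \<Rightarrow> real" where
  "itinerary n g y k = g ((std n g ^^ k) y)"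

definition itinerary_count :: "nat \<Rightarrow> (nat \<Rightarrow> real) \<Rightarrow> (nat \<Rightarrow> real) \<Rightarrow> nat" where
  "itinerary_count n g u = card {y \<in> {1..n}. itinerary n g y = u}"

lemma itinerary_funpow:
  "itinerary n g ((std n g ^^ i) y) = (\<lambda>k. itinerary n g y (k + i))"
  by (simp add: itinerary_def fun_eq_iff funpow_add)

lemma itinerary_std: "itinerary n g (std n g y) = itinerary n g y \<circ> Suc"
  using itinerary_funpow[of n g 1 y] by (simp add: fun_eq_iff)

lemma itinerary_cong:
  assumes "\<And>j. j \<in> {1..n} \<Longrightarrow> g j = h j" "y \<in> {1..n}"
  shows "itinerary n g y = itinerary n h y"
proof
  fix k
  have "(std n g ^^ k) y \<in> {1..n}" using assms(2) by (simp only: funpow_std_in)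
  from assms(1)[OF this] show "itinerary n g y k = itinerary n h y k"
    using std_cong[of n g h] assms(1) by (simp add: itinerary_def)
qed

lemma itinerary_count_cong:
  assumes "\<And>j. j \<in> {1..n} \<Longrightarrow> g j = h j"
  shows "itinerary_count n g = itinerary_count n h"
  unfolding itinerary_count_def using itinerary_cong[OF assms] 
  by (intro ext arg_cong[where f=card]) auto

lemma itinerary_count_pos_iff: "itinerary_count n g u > 0 \<longleftrightarrow> u \<in> itinerary n g ` {1..n}"
  unfolding itinerary_count_def card_gt_0_iff by auto

lemma finite_itinerary_count: "finite {u. itinerary_count n g u > 0}"
  unfolding itinerary_count_pos_iff by simp

lemma sum_itinerary_count:
  assumes "finite U" "itinerary n g ` {1..n} \<subseteq> U"
  shows "sum (itinerary_count n g) U = n"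
proof -
  have "sum (itinerary_count n g) U = (\<Sum>u\<in>U. \<Sum>y\<in>{y\<in>{1..n}. itinerary n g y = u}. 1)"
    unfolding itinerary_count_def by simp
  also have "\<dots> = (\<Sum>y\<in>{1..n}. 1)" by (rule sum.group) (use assms in auto)
  finally show ?thesis by simp
qed

text \<open>The itinerary of \<open>y\<close> starts with \<open>g y\<close>, so the weight of a
  word depends on its itinerary count alone, and multiplicatively. \<open>U\<close> may be larger
  than the set of itineraries, so that different counts can be compared over one index set.\<close>

lemma prod_itinerary_count:
  fixes p :: "real \<Rightarrow> real"
  assumes "finite U" "itinerary n g ` {1..n} \<subseteq> U"
  shows "(\<Prod>u\<in>U. p (u 0) ^ itinerary_count n g u) = (\<Prod>j\<in>{1..n}. p (g j))"
proof -
  have "(\<Prod>u\<in>U. p (u 0) ^ itinerary_count n g u) =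
      (\<Prod>u\<in>U. \<Prod>y\<in>{y\<in>{1..n}. itinerary n g y = u}. p (g y))"
  proof (rule prod.cong[OF refl])
    fix u
    have "(\<Prod>y\<in>{y\<in>{1..n}. itinerary n g y = u}. p (g y)) =
        (\<Prod>y\<in>{y\<in>{1..n}. itinerary n g y = u}. p (u 0))"
      by (rule prod.cong) (auto simp: itinerary_def)
    then show "p (u 0) ^ itinerary_count n g u =
        (\<Prod>y\<in>{y\<in>{1..n}. itinerary n g y = u}. p (g y))"
      by (simp add: itinerary_count_def)
  qed
  also have "\<dots> = (\<Prod>y\<in>{1..n}. p (g y))" by (rule prod.group) (use assms in auto)
  finally show ?thesis .
qed

text \<open>Any positive period counts, not only the least one, so that finitely many words have a
  common one.\<close>

definition has_period :: "nat \<Rightarrow> (nat \<Rightarrow> 'a) \<Rightarrow> bool" where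
  "has_period N u \<longleftrightarrow> N > 0 \<and> (\<forall>k. u (k + N) = u k)"

lemma has_period_mult: "has_period N u \<Longrightarrow> u (k + l * N) = u k"
proof (induction l)
  case (Suc l)
  have "u (k + Suc l * N) = u ((k + l * N) + N)" by (simp add: algebra_simps)
  with Suc show ?case by (simp add: has_period_def)
qed simp

lemma has_period_mod: "has_period N u \<Longrightarrow> u (k mod N) = u k"
  using has_period_mult[of N u "k mod N" "k div N"] by simp

lemma has_period_times: "has_period N u \<Longrightarrow> l > 0 \<Longrightarrow> has_period (l * N) u"
  using has_period_mult[of N u _ l] by (auto simp: has_period_def)

lemma itinerary_has_period:
  assumes "std n g ^^ N = id" "N > 0"
  shows "has_period N (itinerary n g y)"
  using assms by (simp add: has_period_def itinerary_def funpow_add)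

lemma itinerary_periodic: "\<exists>N. has_period N (itinerary n g y)"
  by (rule funpow_permutes_eq_id[OF std_permutes[of n g]]) (use itinerary_has_period in blast)+

text \<open>The permutation maps the points with itinerary \<open>u\<close> injectively to points
  with the shifted itinerary.\<close>

lemma itinerary_count_le_shift:
  "itinerary_count n g u \<le> itinerary_count n g (u \<circ> Suc)"
  unfolding itinerary_count_def
proof (rule card_inj_on_le[of "std n g"])
  show "inj_on (std n g) {y \<in> {1..n}. itinerary n g y = u}"
    by (rule inj_on_subset[OF permutes_inj[OF std_permutes]]) simp
  show "std n g ` {y \<in> {1..n}. itinerary n g y = u} \<subseteq> {y \<in> {1..n}. itinerary n g y = u \<circ> Suc}"
    using permutes_in_image[OF std_permutes[of n g]] itinerary_std by fastforce
qed simp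

text \<open>After \<open>N\<close> shifts the word \<open>u\<close> is back, so the chain of
  inequalities between the counts closes up.\<close>

lemma itinerary_count_shift:
  assumes "has_period N u"
  shows "itinerary_count n g (u \<circ> Suc) = itinerary_count n g u"
proof (rule antisym)
  have le: "itinerary_count n g (u \<circ> Suc) \<le> itinerary_count n g (\<lambda>k. u (k + Suc i))" for i
  proof (induction i)
    case (Suc i)
    show ?case
      using order.trans[OF Suc itinerary_count_le_shift] by (simp add: o_def)
  qed (simp add: o_def)
  have "N > 0" "(\<lambda>k. u (k + N)) = u" using assms by (auto simp: has_period_def)
  then show "itinerary_count n g (u \<circ> Suc) \<le> itinerary_count n g u"
    using le[of "N - 1"] by simp
qed (rule itinerary_count_le_shift)

lemma itinerary_eq_less_iff:
  assumes "itinerary n g y = itinerary n g z" "y \<in> {1..n}" "z \<in> {1..n}"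
  shows "(std n g ^^ k) y < (std n g ^^ k) z \<longleftrightarrow> y < z"
proof (induction k)
  case (Suc k)
  have "(std n g ^^ k) y \<in> {1..n}" "(std n g ^^ k) z \<in> {1..n}"
    using assms by (simp_all only: funpow_std_in)
  moreover have "g ((std n g ^^ k) y) = g ((std n g ^^ k) z)"
    using fun_cong[OF assms(1), of k] by (simp add: itinerary_def)
  ultimately show ?case using Suc std_less_iff by simp
qed simp

lemma no_cyclic_increase:
  fixes f :: "'b::order \<Rightarrow> 'b"
  assumes "f ^^ N = id" "N > 0" "\<And>k. (f ^^ k) y < (f ^^ Suc k) y"
  shows False
  using lift_Suc_mono_less[of "\<lambda>k. (f ^^ k) y", OF assms(3) assms(2)] assms(1) by simp

lemma no_cyclic_decrease:
  fixes f :: "'b::order \<Rightarrow> 'b"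
  assumes "f ^^ N = id" "N > 0" "\<And>k. (f ^^ Suc k) y < (f ^^ k) y"
  shows False
proof -
  have "m > 0 \<Longrightarrow> (f ^^ m) y < y" for m
  proof (induction m)
    case (Suc m) then show ?case using assms(3)[of m] by (cases "m = 0") auto
  qed simp
  from this[OF assms(2)] show False by (simp add: assms(1))
qed

text \<open>Points with equal itineraries are never reordered by the permutation, so a point cannot be
  moved within its own cycle to a point with the same itinerary.\<close>

lemma funpow_std_eq_self:
  assumes "itinerary n g ((std n g ^^ L) y) = itinerary n g y" "y \<in> {1..n}"
  shows "(std n g ^^ L) y = y"
proof (rule ccontr)
  let ?f = "std n g ^^ L"
  assume neq: "?f y \<noteq> y"
  obtain N where N: "N > 0" "std n g ^^ N = id"
    using funpow_permutes_eq_id[OF std_permutes] by auto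
  have id: "?f ^^ N = id"
    using N(2) by (metis funpow_mult mult.commute id_funpow)
  have in_y: "?f y \<in> {1..n}" using assms(2) by (simp only: funpow_std_in)
  have pow: "(?f ^^ k) z = (std n g ^^ (L * k)) z" for k z by (simp add: funpow_mult mult.commute)
  \<comment> \<open>Points with equal itineraries keep their order under all iterates. So the powers
    of \<open>?f\<close> would move \<open>y\<close> strictly in one direction for ever, against
    \<open>?f ^^ N = id\<close>.\<close>
  have less: "(?f ^^ k) y < (?f ^^ Suc k) y \<longleftrightarrow> y < ?f y" 
    "(?f ^^ Suc k) y < (?f ^^ k) y \<longleftrightarrow> ?f y < y" for k
    unfolding funpow_Suc_right comp_apply pow
    using itinerary_eq_less_iff[OF assms(1) in_y assms(2)]
      itinerary_eq_less_iff[OF assms(1)[symmetric] assms(2) in_y] by blast+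
  from neq consider "y < ?f y" | "?f y < y" by linarith
  then show False
    by cases (use less no_cyclic_increase[OF id N(1)] no_cyclic_decrease[OF id N(1)] in blast)+
qed

section \<open>The Gessel--Reutenauer correspondence\<close>

text \<open>For a word of period \<open>N\<close>, the index \<open>(N - 1) * Suc i\<close> stands for \<open>- Suc i\<close>: the order on
  \<open>{1..n}\<close> compares the letters that precede a point on its cycle.\<close>

definition backward_key :: "nat \<Rightarrow> (nat \<Rightarrow> 'a) \<Rightarrow> 'a list" where
  "backward_key N u = map (\<lambda>i. u ((N - 1) * Suc i)) [0..<N]"

lemma backward_key_inject:
  assumes "has_period N u" "has_period N v" "backward_key N u = backward_key N v"
  shows "u = v"
proof
  fix j
  have N: "N > 0" using assms(1) by (simp add: has_period_def)
  then obtain d where d: "N = Suc (j mod N + d)"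
    using less_imp_Suc_add[OF mod_less_divisor[OF N, of j]] by auto
  \<comment> \<open>Modulo \<open>N\<close>, \<open>- Suc d\<close> is \<open>j mod N\<close>,
    because \<open>d = N - 1 - j mod N\<close>. So entry \<open>d\<close> of the key is the letter
    at \<open>j mod N\<close>.\<close>
  have "(N - 1) * Suc d = j mod N + d * N" by (subst (1 3) d) (simp add: algebra_simps)
  moreover have "d < N" using d by simp
  then have "u ((N - 1) * Suc d) = v ((N - 1) * Suc d)"
    using assms(3) by (simp add: backward_key_def del: mult_Suc_right)
  ultimately show "u j = v j"
    using assms(1,2) by (metis has_period_mod has_period_mult)
qed

text \<open>\<open>std\<close> orders \<open>z\<close> and \<open>y\<close> by the letters at their
  preimages and, for equal letters, by the preimages themselves. Unrolled \<open>k\<close> times,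
  this is the lexicographic comparison of the letters read backward.\<close>

lemma backward_word_less:
  assumes "y \<in> {1..n}" "z \<in> {1..n}"
    and "map (\<lambda>i. g ((inv (std n g) ^^ Suc i) z)) [0..<k] < map (\<lambda>i. g ((inv (std n g) ^^ Suc i) y)) [0..<k]"
  shows "z < y"
  using assms
proof (induction k arbitrary: y z)
  case (Suc k)
  let ?t = "inv (std n g)"
  have in_t: "?t y \<in> {1..n}" "?t z \<in> {1..n}"
    using Suc.prems(1,2) by (simp_all only: permutes_in_image[OF permutes_inv[OF std_permutes]])
  have "(?t ^^ Suc (Suc i)) w = (?t ^^ Suc i) (?t w)" for i w
    by (simp only: funpow_Suc_right comp_apply)
  then have *: "map (\<lambda>i. g ((?t ^^ Suc i) w)) [0..<Suc k] =
      g (?t w) # map (\<lambda>i. g ((?t ^^ Suc i) (?t w))) [0..<k]" for w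
    unfolding map_upt_Suc by simp
  have "g (?t z) < g (?t y) \<or> (g (?t z) = g (?t y) \<and> ?t z < ?t y)"
    using Suc.prems(3) Suc.IH[OF in_t] unfolding * by auto
  then have "std n g (?t z) < std n g (?t y)" using std_less_iff[OF in_t(2,1)] by blast
  then show ?case by (simp add: permutes_inverses[OF std_permutes])
qed simp

text \<open>The inverse is the power \<open>N - 1\<close>; this is the origin of the index
  \<open>(N - 1) * Suc i\<close> in \<open>backward_key\<close>.\<close>

lemma funpow_inv_eq:
  assumes "f ^^ N = id" "N > 0"
  shows "inv f ^^ i = f ^^ ((N - 1) * i)"
proof -
  have "f ^^ (N - 1) \<circ> f = id" "f \<circ> f ^^ (N - 1) = id"
    using assms by (metis Suc_diff_1 funpow_Suc_right, metis Suc_diff_1 funpow.simps(2))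
  then have "inv f = f ^^ (N - 1)" by (intro inv_unique_comp)
  then show ?thesis by (simp add: funpow_mult mult.commute)
qed

text \<open>Contrapositive of \<open>backward_word_less\<close> in the linear order of lists.
  Monotonicity is not strict, since points with the same itinerary share their key.\<close>

lemma backward_key_mono:
  assumes "std n g ^^ N = id" "N > 0" "y \<in> {1..n}" "z \<in> {1..n}" "y \<le> z"
  shows "backward_key N (itinerary n g y) \<le> backward_key N (itinerary n g z)"
proof -
  have *: "backward_key N (itinerary n g w) = map (\<lambda>i. g ((inv (std n g) ^^ Suc i) w)) [0..<N]" for w
    unfolding backward_key_def itinerary_def funpow_inv_eq[OF assms(1,2)] ..
  show ?thesis
    using backward_word_less[OF assms(3,4), of g N, folded *] assms(5) by force
qed

text \<open>The word is read off the multiset of its itineraries (a Burrows--Wheeler inversion): the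
  itineraries of \<open>1, \<dots>, n\<close> appear in increasing order of their backward readings.\<close>

theorem itinerary_count_inject:
  assumes "itinerary_count n g = itinerary_count n h" "j \<in> {1..n}"
  shows "g j = h j"
proof -
  obtain N1 where N1: "N1 > 0" "std n g ^^ N1 = id"
    using funpow_permutes_eq_id[OF std_permutes] by auto
  obtain N2 where N2: "N2 > 0" "std n h ^^ N2 = id"
    using funpow_permutes_eq_id[OF std_permutes] by auto
  \<comment> \<open>One exponent for both permutations, so that the keys for \<open>g\<close> and
    for \<open>h\<close> are values of the same function \<open>backward_key N\<close>.\<close>
  define N where "N = N1 * N2"
  have N: "N > 0" "std n g ^^ N = id" "std n h ^^ N = id"
    unfolding N_def using N1 N2
    by (simp, metis funpow_mult id_funpow, metis funpow_mult id_funpow mult.commute)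
  let ?key = "\<lambda>g y. backward_key N (itinerary n g y)"
  have srt: "sorted (map (?key g) [1..<Suc n])" if "std n g ^^ N = id" for g
    unfolding sorted_map
    by (rule sorted_wrt_mono_rel[OF _ sorted_upt])
      (auto intro!: backward_key_mono[OF that N(1)])
  have itin: "count (image_mset (itinerary n g) (mset_set {1..n})) = itinerary_count n g" for g
  proof
    fix u
    have "count (image_mset (itinerary n g) (mset_set {1..n})) u =
        (\<Sum>y\<in>itinerary n g -` {u} \<inter> {1..n}. 1)"
      unfolding count_image_mset by (intro sum.cong) auto
    also have "itinerary n g -` {u} \<inter> {1..n} = {y \<in> {1..n}. itinerary n g y = u}" by auto
    finally show "count (image_mset (itinerary n g) (mset_set {1..n})) u = itinerary_count n g u"
      by (simp add: itinerary_count_def)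
  qed
  have "image_mset (itinerary n g) (mset_set {1..n}) = image_mset (itinerary n h) (mset_set {1..n})"
    using itin assms(1) by (intro multiset_eqI) metis
  then have "image_mset (backward_key N) (image_mset (itinerary n g) (mset_set {1..n})) =
      image_mset (backward_key N) (image_mset (itinerary n h) (mset_set {1..n}))" by simp
  then have "mset (map (?key g) [1..<Suc n]) = mset (map (?key h) [1..<Suc n])"
    by (simp add: image_mset.compositionality o_def atLeastLessThanSuc_atLeastAtMost del: upt_Suc)
  then have "map (?key g) [1..<Suc n] = map (?key h) [1..<Suc n]"
    using srt N by (metis properties_for_sort)
  then have "?key g j = ?key h j" using assms(2) by (auto simp del: upt_Suc)
  then have "itinerary n g j = itinerary n h j"
    using itinerary_has_period N by (intro backward_key_inject) auto
  from fun_cong[OF this, of 0] show ?thesis by (simp add: itinerary_def)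
qed

section \<open>Reconstructing a word from a shift-invariant multiset\<close>

lemma append_less_append_same_length:
  fixes xs ys :: "'a::linorder list"
  assumes "length xs = length ys"
  shows "xs @ us < ys @ vs \<longleftrightarrow> xs < ys \<or> (xs = ys \<and> us < vs)"
  using assms by (induction rule: list_induct2) auto

text \<open>The shift rotates the key: its last letter \<open>u 0\<close> moves to the front. So the
  shifted keys are compared first by \<open>u 0\<close> and then by the old keys, which is the
  defining rule of \<open>std\<close>. The appended \<open>a\<close> and \<open>b\<close> number the
  copies of a word and break ties between equal words.\<close>

lemma backward_key_shift_less_iff:
  fixes u v :: "nat \<Rightarrow> 'a::linorder"
  assumes "has_period N u" "has_period N v"
  shows "backward_key N (u \<circ> Suc) @ [a] < backward_key N (v \<circ> Suc) @ [b] \<longleftrightarrow>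
     u 0 < v 0 \<or> (u 0 = v 0 \<and> backward_key N u @ [a] < backward_key N v @ [b])"
proof -
  have "N > 0" using assms(1) by (simp add: has_period_def)
  then obtain K where K: "N = Suc K" by (cases N) auto
  define pre where "pre = (\<lambda>u::nat\<Rightarrow>'a. map (\<lambda>i. u (K * Suc i)) [0..<K])"
  have key: "backward_key N u = pre u @ [u 0]" if "has_period N u" for u
    using has_period_mult[OF that, of 0 K]
    unfolding backward_key_def pre_def K by (simp add: algebra_simps)
  have key_Suc: "backward_key N (u \<circ> Suc) = u 0 # pre u" if "has_period N u" for u :: "nat \<Rightarrow> 'a"
  proof -
    have "u (Suc K) = u 0" using has_period_mult[OF that, of 0 1] by (simp add: K)
    moreover have "u (Suc (K * Suc (Suc i))) = u (K * Suc i)" for i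
      using has_period_mult[OF that, of "K * Suc i" 1] by (simp add: K algebra_simps)
    ultimately show ?thesis
      unfolding backward_key_def pre_def K map_upt_Suc by simp
  qed
  have "length (pre u) = length (pre v)" by (simp add: pre_def)
  then show ?thesis
    unfolding key[OF assms(1)] key[OF assms(2)] key_Suc[OF assms(1)] key_Suc[OF assms(2)]
    by (auto simp: append_less_append_same_length)
qed

lemma common_period:
  assumes "finite U" "\<And>u. u \<in> U \<Longrightarrow> \<exists>N. has_period N u"
  obtains N where "N > 0" "\<And>u. u \<in> U \<Longrightarrow> has_period N u"
proof -
  from assms(2) obtain P where P: "\<And>u. u \<in> U \<Longrightarrow> has_period (P u) u" by metis
  then have pos: "P u > 0" if "u \<in> U" for u using that by (auto simp: has_period_def)
  have "has_period (prod P U) u" if "u \<in> U" for u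
    using has_period_times[OF P[OF that], of "prod P (U - {u})"] assms(1) that pos
    by (simp add: prod.remove mult.commute prod_pos)
  moreover have "prod P U > 0" using pos by (simp add: prod_pos)
  ultimately show thesis using that by blast
qed

text \<open>The copies of the words, sorted by key, are numbered \<open>1, ..., n\<close>, and under
  this numbering the shift becomes a permutation. By \<open>backward_key_shift_less_iff\<close> it
  is the standardization of the word formed by the first letters.\<close>

theorem itinerary_count_surject:
  fixes m :: "(nat \<Rightarrow> real) \<Rightarrow> nat"
  assumes fin: "finite {u. m u > 0}"
    and per: "\<And>u. m u > 0 \<Longrightarrow> \<exists>N. has_period N u"
    and shift: "\<And>u. m u > 0 \<Longrightarrow> m (u \<circ> Suc) = m u"
    and total: "(\<Sum>u | m u > 0. m u) = n"
  obtains g where "itinerary_count n g = m"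
proof -
  define U where "U = {u. m u > 0}"
  obtain N where N: "N > 0" "\<And>u. u \<in> U \<Longrightarrow> has_period N u"
    using common_period[of U] fin per unfolding U_def by blast
  define E where "E = (SIGMA u:U. {..<m u})"
  have finE: "finite E" using fin by (simp add: E_def U_def)
  have cardE: "card E = n" using fin total by (simp add: E_def U_def)
  \<comment> \<open>The copy number comes last, so it decides only between copies of the same word;
    \<open>real\<close> turns it into a letter.\<close>
  define K where "K = (\<lambda>(u, a). backward_key N u @ [real a])"
  have injK: "inj_on K E"
    using N(2) by (auto simp: inj_on_def K_def E_def intro: backward_key_inject)
  define r where "r e = card {f \<in> E. K f \<le> K e}" for e
  have r_less: "r e < r f" if "e \<in> E" "f \<in> E" "K e < K f" for e f
    unfolding r_def
  proof (rule psubset_card_mono)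
    have "f \<in> {f' \<in> E. K f' \<le> K f}" "f \<notin> {f' \<in> E. K f' \<le> K e}" using that by auto
    moreover have "{f' \<in> E. K f' \<le> K e} \<subseteq> {f' \<in> E. K f' \<le> K f}" using that by auto
    ultimately show "{f' \<in> E. K f' \<le> K e} \<subset> {f' \<in> E. K f' \<le> K f}" by blast
  qed (use finE in simp)
  have r_less_iff: "r e < r f \<longleftrightarrow> K e < K f" if "e \<in> E" "f \<in> E" for e f
    using r_less[OF that] r_less[OF that(2,1)] inj_onD[OF injK _ that]
    by (metis less_asym linorder_less_linear less_irrefl)
  have injr: "inj_on r E"
  proof (rule inj_onI)
    fix e f assume ef: "e \<in> E" "f \<in> E" "r e = r f"
    then have "\<not> K e < K f" "\<not> K f < K e"
      using r_less_iff[OF ef(1,2)] r_less_iff[OF ef(2,1)] by simp_all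
    then show "e = f" using ef by (intro inj_onD[OF injK]) auto
  qed
  have "r ` E \<subseteq> {1..n}"
  proof safe
    fix e assume e: "e \<in> E"
    have "r e \<le> card E" unfolding r_def by (rule card_mono) (use finE in auto)
    moreover have "{f \<in> E. K f \<le> K e} \<noteq> {}" using e by blast
    then have "r e > 0" unfolding r_def using finE by (simp add: card_gt_0_iff)
    ultimately show "r e \<in> {1..n}" using cardE by simp
  qed
  then have "r ` E = {1..n}"
    using cardE card_image[OF injr] by (intro card_subset_eq) auto
  then have bijr: "bij_betw r E {1..n}" using injr by (simp add: bij_betw_def)
  define r' where "r' = inv_into E r"
  have r'_in: "r' j \<in> E" and r_r': "r (r' j) = j" if "j \<in> {1..n}" for j
    using bijr that unfolding r'_def
    by (auto simp: bij_betw_def inv_into_into f_inv_into_f)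
  have r'_r: "r' (r e) = e" if "e \<in> E" for e
    using injr that by (simp add: r'_def)
  \<comment> \<open>The shift keeps the copy number. Shift invariance of \<open>m\<close> makes
    \<open>(u \<circ> Suc, a)\<close> an element of \<open>E\<close> again.\<close>
  define s where "s = (\<lambda>(u::nat\<Rightarrow>real, a::nat). (u \<circ> Suc, a))"
  have s_in: "s e \<in> E" if "e \<in> E" for e
    using that shift by (auto simp: s_def E_def U_def split: prod.splits)
  have injs: "inj_on s E"
  proof (rule inj_onI)
    fix e f assume ef: "e \<in> E" "f \<in> E" "s e = s f"
    obtain u a v b where uv: "e = (u, a)" "f = (v, b)" by fastforce
    have *: "u \<circ> Suc = v \<circ> Suc" "a = b" using ef uv by (auto simp: s_def)
    have "u k = v k" for k
    proof -
      have "u k = u (k + N)" "v k = v (k + N)"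
        using N(2)[of u] N(2)[of v] ef uv by (auto simp: E_def has_period_def)
      moreover have "u (k + N) = v (k + N)"
        using fun_cong[OF *(1), of "k + N - 1"] N(1) by simp
      ultimately show ?thesis by simp
    qed
    then show "e = f" using uv * by auto
  qed
  have bijs: "bij_betw s E E"
    using endo_inj_surj[OF finE _ injs] s_in injs by (simp add: bij_betw_def image_subset_iff)
  define \<sigma> where "\<sigma> j = (if j \<in> {1..n} then r (s (r' j)) else j)" for j
  define g where "g j = fst (r' j) 0" for j
  have "bij_betw r' {1..n} E" unfolding r'_def by (rule bij_betw_inv_into[OF bijr])
  from bij_betw_trans[OF bij_betw_trans[OF this bijs] bijr]
  have "bij_betw \<sigma> {1..n} {1..n}"
    by (rule bij_betw_cong[THEN iffD1, rotated]) (simp add: \<sigma>_def)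
  then have "\<sigma> permutes {1..n}"
    by (rule bij_imp_permutes) (simp only: \<sigma>_def if_False)
  moreover have "\<sigma> j < \<sigma> k \<longleftrightarrow> g j < g k \<or> (g j = g k \<and> j < k)"
    if jk: "j \<in> {1..n}" "k \<in> {1..n}" for j k
  proof -
    obtain u a v b where uv: "r' j = (u, a)" "r' k = (v, b)" by fastforce
    have E: "(u, a) \<in> E" "(v, b) \<in> E" using r'_in[OF jk(1)] r'_in[OF jk(2)] uv by auto
    have "u \<in> U" "v \<in> U" using E by (auto simp: E_def)
    note K_s = backward_key_shift_less_iff[OF this[THEN N(2)]]
    have "\<sigma> j < \<sigma> k \<longleftrightarrow> K (s (u, a)) < K (s (v, b))"
      using r_less_iff[OF E[THEN s_in]] jk uv by (simp add: \<sigma>_def)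
    also have "\<dots> \<longleftrightarrow> u 0 < v 0 \<or> (u 0 = v 0 \<and> K (u, a) < K (v, b))"
      unfolding K_def s_def prod.case by (rule K_s)
    also have "K (u, a) < K (v, b) \<longleftrightarrow> j < k"
      using r_less_iff[OF E] r_r'[OF jk(1)] r_r'[OF jk(2)] uv by simp
    finally show ?thesis using uv by (simp add: g_def)
  qed
  ultimately have "is_std n g \<sigma>" by (simp add: is_std_def)
  then have std: "std n g = \<sigma>" using is_std_std is_std_unique by blast
  have pow: "(\<sigma> ^^ k) (r e) = r ((s ^^ k) e) \<and> (s ^^ k) e \<in> E" if "e \<in> E" for k e
  proof (induction k)
    case (Suc k)
    have "r ((s ^^ k) e) \<in> {1..n}" using Suc bijr by (auto simp: bij_betw_def)
    then show ?case using Suc s_in by (simp add: \<sigma>_def r'_r)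
  qed (use that in simp)
  \<comment> \<open>Shifting \<open>k\<close> times brings letter \<open>k\<close> to the front, so
    the point of rank \<open>r e\<close> has the word of \<open>e\<close> as its itinerary.\<close>
  have s_pow: "fst ((s ^^ k) e) 0 = fst e k" for k e
    by (induction k arbitrary: e) (simp_all add: funpow_swap1 s_def split_beta)
  have itin: "itinerary n g (r e) = fst e" if "e \<in> E" for e
    using pow[OF that] by (simp add: itinerary_def std g_def r'_r s_pow fun_eq_iff)
  have "itinerary_count n g u = m u" for u
  proof -
    have "{y \<in> {1..n}. itinerary n g y = u} = r ` ({u} \<times> {..<m u})"
    proof safe
      fix y assume y: "y \<in> {1..n}" "u = itinerary n g y"
      have "r' y \<in> {itinerary n g y} \<times> {..<m (itinerary n g y)}"
        using itin[OF r'_in[OF y(1)]] r_r'[OF y(1)] r'_in[OF y(1)] by (auto simp: E_def)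
      then show "y \<in> r ` ({itinerary n g y} \<times> {..<m (itinerary n g y)})"
        using r_r'[OF y(1)] by (metis imageI)
    next
      fix a assume "a < m u"
      then have "(u, a) \<in> E" by (simp add: E_def U_def)
      then show "r (u, a) \<in> {1..n}" "itinerary n g (r (u, a)) = u"
        using bijr itin by (auto simp: bij_betw_def)
    qed
    moreover have "{u} \<times> {..<m u} \<subseteq> E" by (auto simp: E_def U_def)
    ultimately show ?thesis
      unfolding itinerary_count_def using card_image[OF inj_on_subset[OF injr]] by simp
  qed
  then show thesis using that by blast
qed

section \<open>Periodic words and cycles\<close>

definition periodic_word :: "'a list \<Rightarrow> nat \<Rightarrow> 'a" where
  "periodic_word w k = w ! (k mod length w)"

lemma has_period_periodic_word: "w \<noteq> [] \<Longrightarrow> has_period (length w) (periodic_word w)"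
  by (simp add: has_period_def periodic_word_def)

lemma periodic_word_rotate:
  "w \<noteq> [] \<Longrightarrow> periodic_word (rotate i w) = (\<lambda>k. periodic_word w (k + i))"
  by (simp add: fun_eq_iff periodic_word_def nth_rotate mod_add_right_eq add.commute)

lemma periodic_word_eqD:
  assumes "periodic_word v = periodic_word w" "length v = length w"
  shows "v = w"
proof (rule nth_equalityI)
  fix i assume "i < length v"
  then show "v ! i = w ! i"
    using fun_cong[OF assms(1), of i] assms(2) by (simp add: periodic_word_def)
qed (rule assms(2))

lemma nth_concat_replicate:
  "i < l * length y \<Longrightarrow> concat (replicate l y) ! i = y ! (i mod length y)"
proof (induction l arbitrary: i)
  case (Suc l)
  then show ?case by (cases "i < length y") (auto simp: nth_append le_mod_geq)
qed simp

text \<open>Stated through the periods of the infinite power, because an itinerary is an infinite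
  word and carries no length. \<open>primitiveI\<close> links it to the absence of a nontrivial
  root.\<close>

definition primitive :: "'a list \<Rightarrow> bool" where
  "primitive w \<longleftrightarrow> w \<noteq> [] \<and> (\<forall>d. has_period d (periodic_word w) \<longrightarrow> length w dvd d)"

text \<open>If \<open>d\<close> and the length \<open>L\<close> are periods, then so is
  \<open>e = gcd d L\<close>, by Bezout. Then \<open>w\<close> is a power of its prefix of length
  \<open>e\<close>, with exponent \<open>L div e\<close>, which must be 1.\<close>

lemma primitiveI:
  assumes "w \<noteq> []" "\<not> nontrivial_power w"
  shows "primitive w"
  unfolding primitive_def
proof (intro conjI allI impI)
  fix d assume d: "has_period d (periodic_word w)"
  let ?u = "periodic_word w"
  define L where "L = length w"
  define e where "e = gcd d L"
  have "d \<noteq> 0" using d by (simp add: has_period_def)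
  then obtain x y where xy: "d * x = L * y + e" using bezout_nat[of d L] by (auto simp: e_def)
  have L: "has_period L ?u" using has_period_periodic_word[OF assms(1)] by (simp add: L_def)
  have e_period: "?u (k + e) = ?u k" for k
  proof -
    have "?u (k + e) = ?u (k + e + y * L)" by (rule has_period_mult[OF L, symmetric])
    also have "k + e + y * L = k + x * d" using xy by (simp add: algebra_simps)
    also have "?u \<dots> = ?u k" by (rule has_period_mult[OF d])
    finally show ?thesis .
  qed
  have "e > 0" using \<open>d \<noteq> 0\<close> by (simp add: e_def)
  then have e: "has_period e ?u" using e_period by (simp add: has_period_def)
  obtain l where l: "L = l * e" using gcd_dvd2[of d L]
    by (metis dvd_def e_def mult.commute)
  have "L > 0" using assms(1) by (simp add: L_def)
  have "e = L"
  proof (rule ccontr)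
    assume "e \<noteq> L"
    then have "l \<ge> 2" using l \<open>L > 0\<close> by (cases l) auto
    have lt: "length (take e w) = e"
      using l \<open>l \<ge> 2\<close> by (cases l) (auto simp: L_def)
    have "w = concat (replicate l (take e w))"
    proof (rule nth_equalityI)
      show "length w = length (concat (replicate l (take e w)))"
        using l lt by (simp add: L_def length_concat sum_list_replicate)
      fix i assume i: "i < length w"
      have "w ! i = ?u i" using i by (simp add: periodic_word_def)
      also have "\<dots> = ?u (i mod e)" by (rule has_period_mod[OF e, symmetric])
      also have "\<dots> = w ! (i mod e)"
        using le_less_trans[OF mod_less_eq_dividend i] by (simp add: periodic_word_def)
      also have "\<dots> = concat (replicate l (take e w)) ! i"
        using i l \<open>e > 0\<close> lt by (subst nth_concat_replicate) (simp_all add: L_def)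
      finally show "w ! i = concat (replicate l (take e w)) ! i" .
    qed
    with \<open>l \<ge> 2\<close> assms(2) show False unfolding nontrivial_power_def by blast
  qed
  then show "length w dvd d" by (metis L_def e_def gcd_dvd1)
qed (rule assms(1))

lemma primitive_rotate:
  assumes "primitive w"
  shows "primitive (rotate i w)"
  unfolding primitive_def
proof (intro conjI allI impI)
  show "rotate i w \<noteq> []" using assms by (simp add: primitive_def)
  fix d assume d: "has_period d (periodic_word (rotate i w))"
  have w: "w \<noteq> []" using assms by (simp add: primitive_def)
  then have L: "length w > 0" by simp
  \<comment> \<open>Moving on by \<open>i * length w - i\<close> undoes the rotation by
    \<open>i\<close> up to whole periods.\<close>
  have "periodic_word w k = periodic_word (rotate i w) (k + (i * length w - i))" for k
  proof -
    have "1 \<le> length w" using L by linarith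
    from mult_le_mono2[OF this, of i]
    have "k + (i * length w - i) + i = k + i * length w" by linarith
    then show ?thesis
      using has_period_mult[OF has_period_periodic_word[OF w], of k i]
      by (simp only: periodic_word_rotate[OF w])
  qed
  then have "has_period d (periodic_word w)"
    using d unfolding has_period_def by (metis add.assoc add.commute)
  then show "length (rotate i w) dvd d" using assms by (simp add: primitive_def)
qed

text \<open>If the shifts by \<open>i \<le> j\<close> agree, then \<open>j - i\<close> is 0 or a
  period of the rotated word, hence a multiple of the length.\<close>

lemma primitive_shift_eq:
  assumes "primitive w" "(\<lambda>k. periodic_word w (k + i)) = (\<lambda>k. periodic_word w (k + j))"
    "i < length w" "j < length w"
  shows "i = j"
proof -
  have w: "w \<noteq> []" using assms(1) by (simp add: primitive_def)
  have *: "i = j" if ij: "i \<le> j" "(\<lambda>k. periodic_word w (k + i)) = (\<lambda>k. periodic_word w (k + j))"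
    "j < length w" for i j
  proof (rule ccontr)
    assume "i \<noteq> j"
    have "periodic_word (rotate i w) (k + (j - i)) = periodic_word (rotate i w) k" for k
      using fun_cong[OF ij(2), of k] ij(1) by (simp add: periodic_word_rotate[OF w] add.assoc)
    then have "has_period (j - i) (periodic_word (rotate i w))"
      using ij(1) \<open>i \<noteq> j\<close> by (simp add: has_period_def)
    then have "length w dvd j - i"
      using primitive_rotate[OF assms(1), of i] by (simp add: primitive_def)
    with ij \<open>i \<noteq> j\<close> show False by (auto dest: dvd_imp_le)
  qed
  show ?thesis
    using *[of i j] *[of j i] assms(2-4) by (cases "i \<le> j") auto
qed

text \<open>Each of the two lengths is a period of the common infinite word, so each divides the
  other.\<close>

lemma primitive_conj:
  assumes "primitive v" "primitive w" "periodic_word v = (\<lambda>k. periodic_word w (k + i))"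
  shows "v = rotate i w"
proof -
  have vw: "v \<noteq> []" "w \<noteq> []" using assms by (simp_all add: primitive_def)
  have eq: "periodic_word v = periodic_word (rotate i w)"
    using assms(3) by (simp add: periodic_word_rotate[OF vw(2)])
  have "length v = length (rotate i w)"
  proof (rule dvd_antisym)
    show "length v dvd length (rotate i w)"
      using assms(1) eq has_period_periodic_word[of "rotate i w"] vw by (simp add: primitive_def)
    show "length (rotate i w) dvd length v"
      using primitive_rotate[OF assms(2), of i] eq has_period_periodic_word[of v] vw
      by (simp add: primitive_def)
  qed
  with eq show ?thesis by (rule periodic_word_eqD)
qed

lemma writes_cycle_nth:
  assumes "writes_cycle n \<sigma> xs"
  shows "(\<sigma> ^^ k) (hd xs) = periodic_word xs k"
proof (induction k)
  case 0
  show ?case using assms by (simp add: periodic_word_def writes_cycle_def hd_conv_nth)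
next
  case (Suc k)
  have xs: "xs \<noteq> []" "map \<sigma> xs = rotate1 xs" using assms by (simp_all add: writes_cycle_def)
  define i where "i = k mod length xs"
  have i: "i < length xs" using xs(1) by (simp add: i_def)
  have "\<sigma> (xs ! i) = map \<sigma> xs ! i" using i by simp
  also have "\<dots> = xs ! (Suc i mod length xs)" unfolding xs(2) using i by (rule nth_rotate1)
  also have "Suc i mod length xs = Suc k mod length xs" by (simp add: i_def mod_Suc_eq)
  finally show ?case using Suc by (simp add: periodic_word_def i_def)
qed

text \<open>A point with itinerary \<open>w w w ...\<close> is back after \<open>length w\<close>
  steps by \<open>funpow_std_eq_self\<close>, and not earlier, because the shifts of a primitive
  word differ. For the same reason a cycle labelled by \<open>w\<close> has exactly one such point,
  so supports and points correspond.\<close>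

theorem cycle_count_eq_itinerary_count:
  assumes "primitive w"
  shows "cycle_count n g w = itinerary_count n g (periodic_word w)"
proof -
  let ?\<sigma> = "std n g" and ?L = "length w"
  define Y where "Y = {y \<in> {1..n}. itinerary n g y = periodic_word w}"
  define C where "C = {xs. writes_cycle n ?\<sigma> xs \<and> map g xs = w}"
  define orb where "orb y = map (\<lambda>i. (?\<sigma> ^^ i) y) [0..<?L]" for y
  have w: "w \<noteq> []" using assms by (simp add: primitive_def)
  have orb_C: "orb y \<in> C" if "y \<in> Y" for y
  proof -
    have y: "y \<in> {1..n}" "itinerary n g y = periodic_word w" using that by (auto simp: Y_def)
    have "itinerary n g ((?\<sigma> ^^ ?L) y) = itinerary n g y"
      using has_period_periodic_word[OF w]
      by (simp add: itinerary_funpow y(2) has_period_def)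
    then have closed: "(?\<sigma> ^^ ?L) y = y" using y(1) by (rule funpow_std_eq_self)
    have "i = j" if ij: "i < ?L" "j < ?L" "(?\<sigma> ^^ i) y = (?\<sigma> ^^ j) y" for i j
    proof (rule primitive_shift_eq[OF assms _ ij(1,2)])
      show "(\<lambda>k. periodic_word w (k + i)) = (\<lambda>k. periodic_word w (k + j))"
        using arg_cong[OF ij(3), of "itinerary n g"] by (simp add: itinerary_funpow y(2))
    qed
    then have "distinct (orb y)" by (auto simp: orb_def distinct_map inj_on_def)
    moreover have "set (orb y) \<subseteq> {1..n}"
      using funpow_std_in y(1) by (fastforce simp: orb_def)
    moreover have "map ?\<sigma> (orb y) = rotate1 (orb y)"
    proof (rule nth_equalityI)
      have step: "?\<sigma> ((?\<sigma> ^^ i) y) = (?\<sigma> ^^ Suc i) y" for i by simp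
      fix i assume "i < length (map ?\<sigma> (orb y))"
      then show "map ?\<sigma> (orb y) ! i = rotate1 (orb y) ! i"
        using closed w step[of i]
        by (cases "Suc i = ?L") (auto simp: orb_def nth_rotate1 simp del: funpow.simps)
    qed (simp add: orb_def)
    moreover have "map g (orb y) = w"
    proof (rule nth_equalityI)
      fix i assume "i < length (map g (orb y))"
      then show "map g (orb y) ! i = w ! i"
        using fun_cong[OF y(2), of i] by (simp add: orb_def itinerary_def periodic_word_def)
    qed (simp add: orb_def)
    ultimately show ?thesis using w by (simp add: C_def writes_cycle_def orb_def)
  qed
  have inj: "inj_on (set \<circ> orb) Y"
  proof (rule inj_onI)
    fix y z assume yz: "y \<in> Y" "z \<in> Y" "(set \<circ> orb) y = (set \<circ> orb) z"
    have "z \<in> set (orb z)" using w by (auto simp: orb_def intro!: image_eqI[of _ _ 0])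
    then have "z \<in> set (orb y)" using yz(3) by simp
    then obtain i where i: "i < ?L" "z = (?\<sigma> ^^ i) y" by (auto simp: orb_def)
    have "(\<lambda>k. periodic_word w (k + i)) = (\<lambda>k. periodic_word w (k + 0))"
      using yz(1,2) i(2) itinerary_funpow[of n g i y] by (simp add: Y_def)
    from primitive_shift_eq[OF assms this i(1)] w i show "y = z" by simp
  qed
  have "set ` C = (set \<circ> orb) ` Y"
  proof safe
    fix xs assume xs: "xs \<in> C"
    then have cyc: "writes_cycle n ?\<sigma> xs" and len: "length xs = ?L" and map: "map g xs = w"
      by (auto simp: C_def)
    have ne: "xs \<noteq> []" using len w by auto
    have "hd xs \<in> {1..n}" using cyc ne hd_in_set unfolding writes_cycle_def by blast
    moreover have "itinerary n g (hd xs) = periodic_word w"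
      using ne len unfolding map[symmetric]
      by (simp add: itinerary_def fun_eq_iff writes_cycle_nth[OF cyc] periodic_word_def)
    ultimately have "hd xs \<in> Y" by (simp add: Y_def)
    moreover have "orb (hd xs) = xs"
      by (rule nth_equalityI)
        (auto simp: orb_def len writes_cycle_nth[OF cyc] periodic_word_def)
    ultimately show "set xs \<in> (set \<circ> orb) ` Y" by (intro image_eqI[of _ _ "hd xs"]) auto
  qed (use orb_C in auto)
  moreover have "{set xs | xs. writes_cycle n ?\<sigma> xs \<and> map g xs = w} = set ` C"
    by (auto simp: C_def)
  ultimately show ?thesis
    unfolding cycle_count_def itinerary_count_def using card_image[OF inj] by (simp add: Y_def)
qed

lemma primitive_classes_upto_cases:
  assumes "c \<in> primitive_classes_upto I k"
  shows "primitive (rep c)" "set (rep c) \<subseteq> I" "length (rep c) \<le> k" "c = conj_words `` {rep c}"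
proof -
  from assms obtain l where l: "1 \<le> l" "l \<le> k" and cl: "c \<in> primitive_classes I l"
    unfolding primitive_classes_upto_def by (metis UN_E atLeastAtMost_iff)
  from cl obtain w where w: "w \<in> primitive_words I l" and c: "c = conj_words `` {w}"
    unfolding primitive_classes_def by (rule quotientE)
  have "w \<in> c" using c equiv_class_self[OF equiv_conj_words] by simp
  then have conj: "(rep c, w) \<in> conj_words" using rep_conj cl by blast
  then have "(w, rep c) \<in> conj_words"
    using equiv_conj_words unfolding equiv_def by (blast dest: symD)
  then obtain i where i: "rep c = rotate i w" by (auto simp: conj_words_def)
  have "primitive w" using w l by (intro primitiveI) (auto simp: primitive_words_def)
  then show "primitive (rep c)" unfolding i by (rule primitive_rotate)
  show "set (rep c) \<subseteq> I" "length (rep c) \<le> k"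
    using w l unfolding i by (auto simp: primitive_words_def)
  show "c = conj_words `` {rep c}"
    using equiv_class_eq[OF equiv_conj_words conj] c by simp
qed

text \<open>It makes the orbits \<open>word_orbit (rep c)\<close> of different classes disjoint, so
  that a point lies on cycles of one class only.\<close>

lemma rep_conj_imp_eq:
  assumes "c \<in> primitive_classes_upto I k" "c' \<in> primitive_classes_upto I k"
    and "periodic_word (rep c) = (\<lambda>k. periodic_word (rep c') (k + i))"
  shows "c = c'"
proof -
  have "rep c = rotate i (rep c')"
    by (rule primitive_conj[OF primitive_classes_upto_cases(1)[OF assms(1)]
          primitive_classes_upto_cases(1)[OF assms(2)] assms(3)])
  then have "(rep c', rep c) \<in> conj_words" by (auto simp: conj_words_def)
  then have "conj_words `` {rep c'} = conj_words `` {rep c}"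
    by (rule equiv_class_eq[OF equiv_conj_words])
  then show ?thesis
    using primitive_classes_upto_cases(4)[OF assms(1)] primitive_classes_upto_cases(4)[OF assms(2)]
    by simp
qed

lemma countable_primitive_classes_upto:
  assumes "countable I"
  shows "countable (primitive_classes_upto I k)"
proof -
  have "primitive_classes_upto I k \<subseteq> (\<lambda>w. conj_words `` {w}) ` lists I"
    by (auto simp: primitive_classes_upto_def primitive_classes_def quotient_def primitive_words_def)
  then show ?thesis using assms by (meson countable_image countable_lists countable_subset)
qed

text \<open>The itineraries of the points of a cycle labelled by \<open>w\<close>.\<close>

definition word_orbit :: "'a list \<Rightarrow> (nat \<Rightarrow> 'a) set" where
  "word_orbit w = range (\<lambda>i k. periodic_word w (k + i))"

lemma word_orbit_eq:
  assumes "w \<noteq> []"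
  shows "word_orbit w = (\<lambda>i k. periodic_word w (k + i)) ` {..<length w}"
  unfolding word_orbit_def
proof safe
  fix i
  have "(\<lambda>k. periodic_word w (k + i)) = (\<lambda>k. periodic_word w (k + i mod length w))"
    by (simp add: periodic_word_def fun_eq_iff mod_add_right_eq)
  then show "(\<lambda>k. periodic_word w (k + i)) \<in> (\<lambda>i k. periodic_word w (k + i)) ` {..<length w}"
    using assms by (intro image_eqI[of _ _ "i mod length w"]) auto
qed auto

lemma periodic_word_in_orbit: "periodic_word w \<in> word_orbit w"
  unfolding word_orbit_def by (rule range_eqI[of _ _ 0]) simp

lemma finite_word_orbit: "w \<noteq> [] \<Longrightarrow> finite (word_orbit w)"
  by (simp add: word_orbit_eq)

lemma has_period_word_orbit:
  "w \<noteq> [] \<Longrightarrow> u \<in> word_orbit w \<Longrightarrow> has_period (length w) u"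
  by (auto simp: word_orbit_def has_period_def periodic_word_def add.assoc add.commute[of "length w"])
    (metis add.assoc mod_add_self2)

text \<open>The way back from the shifted word uses the period: \<open>N - 1\<close> further shifts
  lead from \<open>u \<circ> Suc\<close> to \<open>u\<close>.\<close>

lemma shift_in_word_orbit_iff:
  assumes "has_period N u"
  shows "u \<circ> Suc \<in> word_orbit w \<longleftrightarrow> u \<in> word_orbit w"
proof
  assume "u \<in> word_orbit w"
  then obtain i where "u = (\<lambda>k. periodic_word w (k + i))" by (auto simp: word_orbit_def)
  then have "u \<circ> Suc = (\<lambda>k. periodic_word w (k + Suc i))" by auto
  then show "u \<circ> Suc \<in> word_orbit w" unfolding word_orbit_def by (rule range_eqI)
next
  assume "u \<circ> Suc \<in> word_orbit w"
  then obtain i where i: "u \<circ> Suc = (\<lambda>k. periodic_word w (k + i))" by (auto simp: word_orbit_def)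
  have "u k = periodic_word w (k + (N - 1 + i))" for k
    using fun_cong[OF i, of "k + (N - 1)"] assms by (simp add: has_period_def add.assoc)
  then have "u = (\<lambda>k. periodic_word w (k + (N - 1 + i)))" by blast
  then show "u \<in> word_orbit w" unfolding word_orbit_def by (rule range_eqI)
qed

lemma inj_on_word_orbit:
  "primitive w \<Longrightarrow> inj_on (\<lambda>i k. periodic_word w (k + i)) {..<length w}"
  by (auto simp: inj_on_def intro: primitive_shift_eq)

lemma card_word_orbit: "primitive w \<Longrightarrow> card (word_orbit w) = length w"
  using card_image[OF inj_on_word_orbit] word_orbit_eq[of w] by (simp add: primitive_def)

text \<open>The first letters of the different shifts of \<open>w\<close> are the letters of
  \<open>w\<close>, each position once.\<close>

lemma prod_word_orbit:
  fixes p :: "'a \<Rightarrow> real"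
  assumes "primitive w"
  shows "(\<Prod>u\<in>word_orbit w. p (u 0)) = word_weight p w"
proof -
  have w: "w \<noteq> []" using assms by (simp add: primitive_def)
  have "(\<Prod>u\<in>word_orbit w. p (u 0)) = (\<Prod>i<length w. p (w ! i))"
    unfolding word_orbit_eq[OF w] prod.reindex[OF inj_on_word_orbit[OF assms]]
    by (auto intro!: prod.cong simp: periodic_word_def)
  also have "\<dots> = word_weight p w"
    unfolding word_weight_def prod.list_conv_set_nth by (simp add: lessThan_atLeast0)
  finally show ?thesis .
qed

lemma word_orbit_values: "w \<noteq> [] \<Longrightarrow> u \<in> word_orbit w \<Longrightarrow> u k \<in> set w"
  by (auto simp: word_orbit_def periodic_word_def)

section \<open>Adding prescribed cycles to a random word\<close>

text \<open>Extensional functions, so that a word is determined by its letters on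
  \<open>{1..n}\<close> and equal itinerary counts force equal words.\<close>

abbreviation words :: "real set \<Rightarrow> nat \<Rightarrow> (nat \<Rightarrow> real) set" where
  "words I n \<equiv> {1..n} \<rightarrow>\<^sub>E I"

lemma itinerary_in_words:
  assumes "g \<in> words I n" "itinerary_count n g u > 0"
  shows "u k \<in> I"
proof -
  obtain y where "y \<in> {1..n}" "u = itinerary n g y"
    using assms(2) unfolding itinerary_count_pos_iff by blast
  then show ?thesis
    using assms(1) funpow_std_in[of k n g y] unfolding itinerary_def by (auto simp: PiE_iff)
qed

lemma itinerary_count_surject_words:
  assumes "finite {u. m u > 0}" "\<And>u. m u > 0 \<Longrightarrow> \<exists>N. has_period N u"
    "\<And>u. m u > 0 \<Longrightarrow> m (u \<circ> Suc) = m u" "(\<Sum>u | m u > 0. m u) = n"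
    "\<And>u. m u > 0 \<Longrightarrow> u 0 \<in> I"
  obtains g where "g \<in> words I n" "itinerary_count n g = m"
proof -
  obtain h where h: "itinerary_count n h = m"
    using itinerary_count_surject[OF assms(1-4)] by blast
  have "h j \<in> I" if "j \<in> {1..n}" for j
  proof -
    have "m (itinerary n h j) > 0" unfolding h[symmetric] itinerary_count_pos_iff using that by blast
    from assms(5)[OF this] show ?thesis by (simp add: itinerary_def)
  qed
  then have "restrict h {1..n} \<in> words I n" by auto
  moreover have "itinerary_count n (restrict h {1..n}) = m"
    unfolding h[symmetric] by (rule itinerary_count_cong) simp
  ultimately show thesis by (rule that)
qed

lemma itinerary_count_inject_words:
  assumes "itinerary_count n g = itinerary_count n h" "g \<in> words I n" "h \<in> words I n"
  shows "g = h"
  using itinerary_count_inject[OF assms(1)] assms(2,3) by (intro PiE_ext) auto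

text \<open>Here \<open>\<mu>\<close> is the multiset of itineraries of the cycles to be added.\<close>

lemma add_cycles_bij:
  fixes p :: "real \<Rightarrow> real" and \<mu> :: "(nat \<Rightarrow> real) \<Rightarrow> nat"
  assumes fin: "finite {u. \<mu> u > 0}"
    and per: "\<And>u. \<mu> u > 0 \<Longrightarrow> \<exists>N. has_period N u"
    and shift: "\<And>u N. has_period N u \<Longrightarrow> \<mu> (u \<circ> Suc) = \<mu> u"
    and total: "(\<Sum>u | \<mu> u > 0. \<mu> u) = s"
    and val: "\<And>u. \<mu> u > 0 \<Longrightarrow> u 0 \<in> I"
  shows "\<exists>T. bij_betw T (words I n) {g \<in> words I (n + s). \<forall>u. \<mu> u \<le> itinerary_count (n + s) g u} \<and>
    (\<forall>g\<in>words I n. (\<Prod>j\<in>{1..n + s}. p (T g j)) =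
        (\<Prod>u | \<mu> u > 0. p (u 0) ^ \<mu> u) * (\<Prod>j\<in>{1..n}. p (g j)))"
proof -
  let ?c = itinerary_count
  have sum_c: "sum (?c n g) U = n" if "finite U" "{u. ?c n g u > 0} \<subseteq> U" for n g U
    using that sum_itinerary_count[of U n g] by (simp add: itinerary_count_pos_iff)
  have prod_c: "(\<Prod>u\<in>U. p (u 0) ^ ?c n g u) = (\<Prod>j\<in>{1..n}. p (g j))"
    if "finite U" "{u. ?c n g u > 0} \<subseteq> U" for n g U
    using that prod_itinerary_count[of U n g] by (simp add: itinerary_count_pos_iff)
  have sum_\<mu>: "sum \<mu> U = s" if "finite U" "{u. \<mu> u > 0} \<subseteq> U" for U
    unfolding total[symmetric] by (rule sum.mono_neutral_right) (use that in auto)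
  have c_shift: "?c n g (u \<circ> Suc) = ?c n g u" if "has_period N u" for n g u N
    using itinerary_count_shift[OF that] .
  have c_per: "\<exists>N. has_period N u" if "?c n g u > 0" for n g u
    using that itinerary_periodic unfolding itinerary_count_pos_iff by blast
  \<comment> \<open>Adding cycles is addition of multisets; the sum is again finite, periodic and
    shift-invariant, with total \<open>n + s\<close>.\<close>
  have "\<exists>g'. g' \<in> words I (n + s) \<and> ?c (n + s) g' = (\<lambda>u. ?c n g u + \<mu> u)" if g: "g \<in> words I n" for g
  proof -
    let ?m = "\<lambda>u. ?c n g u + \<mu> u"
    have U: "{u. ?m u > 0} = {u. ?c n g u > 0} \<union> {u. \<mu> u > 0}" by auto
    then have finU: "finite {u. ?m u > 0}" using fin finite_itinerary_count by simp
    have "(\<Sum>u | ?m u > 0. ?m u) = n + s"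
      unfolding sum.distrib using sum_c[OF finU] sum_\<mu>[OF finU] U by auto
    moreover have "\<exists>N. has_period N u" if "?m u > 0" for u using that per c_per by auto
    moreover have "?m (u \<circ> Suc) = ?m u" if "?m u > 0" for u
    proof -
      have "?c n g u > 0 \<or> \<mu> u > 0" using that by auto
      then obtain N where "has_period N u" using per c_per by blast
      then show ?thesis using c_shift[of N u n g] shift[of N u] by simp
    qed
    moreover have "u 0 \<in> I" if "?m u > 0" for u using that val itinerary_in_words[OF g] by auto
    ultimately obtain g' where "g' \<in> words I (n + s)" "?c (n + s) g' = ?m"
      using itinerary_count_surject_words[of ?m "n + s" I, OF finU] by blast
    then show ?thesis by blast
  qed
  note ex = this
  define T where "T g = (SOME g'. g' \<in> words I (n + s) \<and> ?c (n + s) g' = (\<lambda>u. ?c n g u + \<mu> u))" for g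
  have T: "T g \<in> words I (n + s)" "?c (n + s) (T g) = (\<lambda>u. ?c n g u + \<mu> u)" if "g \<in> words I n" for g
    using someI_ex[OF ex[OF that]] unfolding T_def by blast+
  have inj: "inj_on T (words I n)"
  proof (rule inj_onI)
    fix g h assume gh: "g \<in> words I n" "h \<in> words I n" "T g = T h"
    have "(\<lambda>u. ?c n g u + \<mu> u) = (\<lambda>u. ?c n h u + \<mu> u)" using T(2)[OF gh(1)] T(2)[OF gh(2)] gh(3) by simp
    then have "?c n g = ?c n h" by (simp add: fun_eq_iff)
    then show "g = h" using gh(1,2) by (rule itinerary_count_inject_words)
  qed
  have surj: "T ` words I n = {g \<in> words I (n + s). \<forall>u. \<mu> u \<le> ?c (n + s) g u}"
  proof (intro subset_antisym subsetI)
    fix g' assume "g' \<in> {g \<in> words I (n + s). \<forall>u. \<mu> u \<le> ?c (n + s) g u}"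
    then have g': "g' \<in> words I (n + s)" and le: "\<forall>u. \<mu> u \<le> ?c (n + s) g' u" by auto
    \<comment> \<open>The preimage is found by taking the cycles away: the difference is
      shift-invariant because both terms are, so it is the itinerary count of some
      \<open>g\<close>.\<close>
    let ?m = "\<lambda>u. ?c (n + s) g' u - \<mu> u" and ?U = "{u. ?c (n + s) g' u > 0}"
    have U: "{u. \<mu> u > 0} \<subseteq> ?U" using le by (auto intro: less_le_trans)
    have finU: "finite ?U" by (rule finite_itinerary_count)
    have pos: "?c (n + s) g' u > 0" if "?m u > 0" for u using that by simp
    have fin_m: "finite {u. ?m u > 0}" by (rule finite_subset[OF _ finU]) auto
    have "(\<Sum>u | ?m u > 0. ?m u) = (\<Sum>u\<in>?U. ?m u)"
      by (rule sum.mono_neutral_left) (use finU in auto)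
    also have "\<dots> = sum (?c (n + s) g') ?U - sum \<mu> ?U"
      by (rule sum_subtractf_nat) (use le in auto)
    also have "\<dots> = n" using sum_c[OF finU] sum_\<mu>[OF finU U] by simp
    finally have "(\<Sum>u | ?m u > 0. ?m u) = n" .
    moreover have "\<exists>N. has_period N u" if "?m u > 0" for u using c_per[OF pos[OF that]] .
    moreover have "?m (u \<circ> Suc) = ?m u" if m: "?m u > 0" for u
    proof -
      obtain N where N: "has_period N u" using c_per[OF pos[OF m]] by blast
      show ?thesis unfolding c_shift[OF N] shift[OF N] ..
    qed
    moreover have "u 0 \<in> I" if "?m u > 0" for u using itinerary_in_words[OF g' pos[OF that]] .
    ultimately obtain g where g: "g \<in> words I n" "?c n g = ?m"
      using itinerary_count_surject_words[of ?m n I, OF fin_m] by blast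
    have "?c (n + s) (T g) = ?c (n + s) g'" using T(2)[OF g(1)] g(2) le by (simp add: fun_eq_iff)
    then have "T g = g'" using T(1)[OF g(1)] g' by (rule itinerary_count_inject_words)
    then show "g' \<in> T ` words I n" using g(1) by blast
  next
    fix g' assume "g' \<in> T ` words I n"
    then obtain g where g: "g \<in> words I n" "g' = T g" by blast
    show "g' \<in> {g \<in> words I (n + s). \<forall>u. \<mu> u \<le> ?c (n + s) g u}"
      unfolding g(2) mem_Collect_eq using T(1)[OF g(1)] by (simp only: T(2)[OF g(1)] le_add2 simp_thms)
  qed
  have "(\<Prod>j\<in>{1..n + s}. p (T g j)) =
      (\<Prod>u | \<mu> u > 0. p (u 0) ^ \<mu> u) * (\<Prod>j\<in>{1..n}. p (g j))" if g: "g \<in> words I n" for g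
  proof -
    let ?U = "{u. ?c (n + s) (T g) u > 0}"
    have U: "?U = {u. ?c n g u > 0} \<union> {u. \<mu> u > 0}" using T(2)[OF g] by auto
    have finU: "finite ?U" by (rule finite_itinerary_count)
    have "(\<Prod>j\<in>{1..n + s}. p (T g j)) = (\<Prod>u\<in>?U. p (u 0) ^ ?c (n + s) (T g) u)"
      using prod_c[OF finU] by simp
    also have "\<dots> = (\<Prod>u\<in>?U. p (u 0) ^ ?c n g u) * (\<Prod>u\<in>?U. p (u 0) ^ \<mu> u)"
      by (simp only: T(2)[OF g] power_add prod.distrib)
    also have "(\<Prod>u\<in>?U. p (u 0) ^ ?c n g u) = (\<Prod>j\<in>{1..n}. p (g j))"
      using prod_c[OF finU] U by auto
    also have "(\<Prod>u\<in>?U. p (u 0) ^ \<mu> u) = (\<Prod>u | \<mu> u > 0. p (u 0) ^ \<mu> u)"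
      by (rule prod.mono_neutral_right) (use finU U in auto)
    finally show ?thesis by (simp add: mult.commute)
  qed
  moreover have "bij_betw T (words I n) {g \<in> words I (n + s). \<forall>u. \<mu> u \<le> ?c (n + s) g u}"
    using inj surj by (simp add: bij_betw_def)
  ultimately show ?thesis by blast
qed

section \<open>The law of the random word\<close>

locale random_words =
  fixes I :: "real set" and p :: "real \<Rightarrow> real"
    and M :: "nat \<Rightarrow> 'a measure" and G :: "nat \<Rightarrow> nat \<Rightarrow> 'a \<Rightarrow> real"
  assumes countable_I: "countable I"
    and p_nonneg: "\<And>i. i \<in> I \<Longrightarrow> 0 \<le> p i"
    and p_less_1: "\<And>i. i \<in> I \<Longrightarrow> p i < 1"
    and prob_space_M: "\<And>n. n \<ge> 1 \<Longrightarrow> prob_space (M n)"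
    and indep: "\<And>n. n \<ge> 1 \<Longrightarrow> prob_space.indep_vars (M n) (\<lambda>_. count_space I) (G n) {1..n}"
    and prob_letter: "\<And>n j i. n \<ge> 1 \<Longrightarrow> j \<in> {1..n} \<Longrightarrow> i \<in> I \<Longrightarrow>
           measure (M n) {\<omega> \<in> space (M n). G n j \<omega> = i} = p i"
begin

definition word :: "nat \<Rightarrow> 'a \<Rightarrow> nat \<Rightarrow> real" where
  "word n \<omega> = (\<lambda>j\<in>{1..n}. G n j \<omega>)"

lemma countable_words: "countable (words I n)"
  using countable_I by (intro countable_PiE) auto

lemma G_measurable:
  assumes "n \<ge> 1" "j \<in> {1..n}"
  shows "G n j \<in> M n \<rightarrow>\<^sub>M count_space I"
proof -
  interpret prob_space "M n" using assms(1) by (rule prob_space_M)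
  show ?thesis using indep[OF assms(1)] assms(2) unfolding indep_vars_def by auto
qed

lemma word_in_words: "n \<ge> 1 \<Longrightarrow> \<omega> \<in> space (M n) \<Longrightarrow> word n \<omega> \<in> words I n"
  using measurable_space[OF G_measurable[of n]] by (auto simp: word_def)

lemma word_vimage_singleton:
  assumes "n \<ge> 1" "g \<in> words I n"
  shows "word n -` {g} \<inter> space (M n) = (\<Inter>j\<in>{1..n}. G n j -` {g j} \<inter> space (M n))"
proof -
  have "word n \<omega> = g \<longleftrightarrow> (\<forall>j\<in>{1..n}. G n j \<omega> = g j)" for \<omega>
  proof
    assume "\<forall>j\<in>{1..n}. G n j \<omega> = g j"
    then show "word n \<omega> = g"
      using assms(2) by (intro extensionalityI[of _ "{1..n}"]) (auto simp: word_def PiE_def)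
  qed (auto simp: word_def)
  then show ?thesis using assms(1) by (auto simp: set_eq_iff)
qed

lemma word_measurable:
  assumes "n \<ge> 1"
  shows "word n \<in> M n \<rightarrow>\<^sub>M count_space (words I n)"
  unfolding measurable_count_space_eq_countable[OF countable_words]
proof (intro conjI ballI)
  fix g assume g: "g \<in> words I n"
  show "word n -` {g} \<inter> space (M n) \<in> sets (M n)"
    unfolding word_vimage_singleton[OF assms g]
    using assms measurable_sets[OF G_measurable[OF assms]] PiE_mem[OF g]
    by (intro sets.finite_INT) auto
qed (use word_in_words[OF assms] in auto)

lemma prob_word:
  assumes "n \<ge> 1" "g \<in> words I n"
  shows "measure (M n) (word n -` {g} \<inter> space (M n)) = (\<Prod>j\<in>{1..n}. p (g j))"
proof -
  interpret prob_space "M n" using assms(1) by (rule prob_space_M)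
  have "measure (M n) (word n -` {g} \<inter> space (M n)) =
      (\<Prod>j\<in>{1..n}. prob (G n j -` {g j} \<inter> space (M n)))"
    unfolding word_vimage_singleton[OF assms]
    using indep[OF assms(1)] assms by (intro indep_varsD_finite) auto
  also have "\<dots> = (\<Prod>j\<in>{1..n}. p (g j))"
  proof (rule prod.cong[OF refl])
    fix j assume j: "j \<in> {1..n}"
    have "G n j -` {g j} \<inter> space (M n) = {\<omega> \<in> space (M n). G n j \<omega> = g j}" by auto
    then show "prob (G n j -` {g j} \<inter> space (M n)) = p (g j)"
      using prob_letter[OF assms(1) j PiE_mem[OF assms(2) j]] by simp
  qed
  finally show ?thesis .
qed

text \<open>The nonnegative integral over a counting measure is the sum over the countable set
  \<open>A\<close>; in this form the later change of variables raises no question of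
  summability.\<close>

lemma emeasure_word:
  assumes "n \<ge> 1" "A \<subseteq> words I n"
  shows "emeasure (M n) (word n -` A \<inter> space (M n)) =
    (\<integral>\<^sup>+g. ennreal (\<Prod>j\<in>{1..n}. p (g j)) \<partial>count_space A)"
proof -
  interpret prob_space "M n" using assms(1) by (rule prob_space_M)
  have "word n -` A \<inter> space (M n) = (\<Union>g\<in>A. word n -` {g} \<inter> space (M n))" by auto
  also have "emeasure (M n) \<dots> = (\<integral>\<^sup>+g. emeasure (M n) (word n -` {g} \<inter> space (M n)) \<partial>count_space A)"
    using assms(2) measurable_sets[OF word_measurable[OF assms(1)]] countable_words
    by (intro emeasure_UN_countable) (auto simp: disjoint_family_on_def intro: countable_subset)
  also have "\<dots> = (\<integral>\<^sup>+g. ennreal (\<Prod>j\<in>{1..n}. p (g j)) \<partial>count_space A)"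
    using assms by (intro nn_integral_cong) (auto simp: emeasure_eq_measure prob_word subset_iff)
  finally show ?thesis .
qed

lemma itinerary_count_word: "itinerary_count n (word n \<omega>) = itinerary_count n (\<lambda>j. G n j \<omega>)"
  by (rule itinerary_count_cong) (simp add: word_def)

text \<open>By \<open>add_cycles_bij\<close> the event consists of the images of all words of the
  smaller length \<open>n0\<close>, every weight being multiplied by the same constant.\<close>

lemma prob_itinerary_count_ge:
  fixes \<mu> :: "(nat \<Rightarrow> real) \<Rightarrow> nat"
  assumes "finite {u. \<mu> u > 0}" "\<And>u. \<mu> u > 0 \<Longrightarrow> \<exists>N. has_period N u"
    and "\<And>u N. has_period N u \<Longrightarrow> \<mu> (u \<circ> Suc) = \<mu> u"
    and "\<And>u. \<mu> u > 0 \<Longrightarrow> u 0 \<in> I" and n: "n > (\<Sum>u | \<mu> u > 0. \<mu> u)"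
  shows "measure (M n) {\<omega> \<in> space (M n). \<forall>u. \<mu> u \<le> itinerary_count n (\<lambda>j. G n j \<omega>) u} =
    (\<Prod>u | \<mu> u > 0. p (u 0) ^ \<mu> u)"
proof -
  define s where "s = (\<Sum>u | \<mu> u > 0. \<mu> u)"
  obtain n0 where n0: "n = n0 + s" "n0 \<ge> 1"
    by (rule that[of "n - s"]) (use n in \<open>simp_all add: s_def\<close>)
  have "n \<ge> 1" using n0 by simp
  interpret prob_space "M n" using \<open>n \<ge> 1\<close> by (rule prob_space_M)
  define A where "A = {g \<in> words I n. \<forall>u. \<mu> u \<le> itinerary_count n g u}"
  define c where "c = (\<Prod>u | \<mu> u > 0. p (u 0) ^ \<mu> u)"
  have c: "c \<ge> 0" unfolding c_def using p_nonneg assms(4) by (intro prod_nonneg) auto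
  have "\<exists>T. bij_betw T (words I n0) A \<and>
      (\<forall>g\<in>words I n0. (\<Prod>j\<in>{1..n}. p (T g j)) = c * (\<Prod>j\<in>{1..n0}. p (g j)))"
    unfolding A_def c_def n0(1) by (rule add_cycles_bij) (fact assms(1-4) s_def[symmetric])+
  then obtain T where T: "bij_betw T (words I n0) A"
    "\<And>g. g \<in> words I n0 \<Longrightarrow> (\<Prod>j\<in>{1..n}. p (T g j)) = c * (\<Prod>j\<in>{1..n0}. p (g j))"
    by blast
  have "{\<omega> \<in> space (M n). \<forall>u. \<mu> u \<le> itinerary_count n (\<lambda>j. G n j \<omega>) u} = word n -` A \<inter> space (M n)"
    using word_in_words[OF \<open>n \<ge> 1\<close>] by (auto simp: A_def itinerary_count_word)
  also have "emeasure (M n) \<dots> = (\<integral>\<^sup>+g. ennreal (\<Prod>j\<in>{1..n}. p (g j)) \<partial>count_space A)"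
    using \<open>n \<ge> 1\<close> by (rule emeasure_word) (simp add: A_def)
  also have "\<dots> = (\<integral>\<^sup>+g. ennreal (\<Prod>j\<in>{1..n}. p (T g j)) \<partial>count_space (words I n0))"
    by (rule nn_integral_bij_count_space[OF T(1), symmetric])
  also have "\<dots> = (\<integral>\<^sup>+g. ennreal c * ennreal (\<Prod>j\<in>{1..n0}. p (g j)) \<partial>count_space (words I n0))"
  proof (rule nn_integral_cong)
    fix g assume "g \<in> space (count_space (words I n0))"
    then have g: "g \<in> words I n0" by simp
    show "ennreal (\<Prod>j\<in>{1..n}. p (T g j)) = ennreal c * ennreal (\<Prod>j\<in>{1..n0}. p (g j))"
      unfolding T(2)[OF g] using c p_nonneg PiE_mem[OF g] by (intro ennreal_mult prod_nonneg) auto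
  qed
  also have "\<dots> = ennreal c * emeasure (M n0) (word n0 -` words I n0 \<inter> space (M n0))"
    using emeasure_word[OF n0(2), of "words I n0"] by (simp add: nn_integral_cmult)
  also have "word n0 -` words I n0 \<inter> space (M n0) = space (M n0)"
    using word_in_words[OF n0(2)] by auto
  \<comment> \<open>The words of length \<open>n0\<close> have total weight 1 because
    \<open>M n0\<close> is a probability space. This rests on \<open>n0 \<ge> 1\<close>, hence the
    strict inequality between \<open>n\<close> and the number of added points.\<close>
  also have "emeasure (M n0) (space (M n0)) = 1"
    using prob_space_M[OF n0(2)] by (rule prob_space.emeasure_space_1)
  finally show ?thesis using c by (simp add: emeasure_eq_measure c_def)
qed

end

section \<open>Joint tails of the cycle counts\<close>

lemma word_orbit_invariant:
  assumes "\<And>u N. has_period N u \<Longrightarrow> f (u \<circ> Suc) = f u" "w \<noteq> []" "u \<in> word_orbit w"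
  shows "f u = f (periodic_word w)"
proof -
  have "f (\<lambda>k. periodic_word w (k + i)) = f (periodic_word w)" for i
  proof (induction i)
    case (Suc i)
    have "has_period (length w) (\<lambda>k. periodic_word w (k + i))"
      using assms(2) by (intro has_period_word_orbit) (auto simp: word_orbit_def)
    from assms(1)[OF this] Suc show ?case by (simp add: o_def)
  qed simp
  then show ?thesis using assms(3) by (auto simp: word_orbit_def)
qed

text \<open>The itinerary count of a permutation made of exactly \<open>m c\<close> cycles labelled
  \<open>rep c\<close> for each \<open>c \<in> A\<close>: each such cycle has one point for every
  shift of \<open>rep c\<close>.\<close>

definition cycles_multiplicity ::
    "real list set set \<Rightarrow> (real list set \<Rightarrow> nat) \<Rightarrow> (nat \<Rightarrow> real) \<Rightarrow> nat" where
  "cycles_multiplicity A m u = (\<Sum>c\<in>A. if u \<in> word_orbit (rep c) then m c else 0)"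

context
  fixes A :: "real list set set" and I :: "real set" and k :: nat
  assumes A: "finite A" "A \<subseteq> primitive_classes_upto I k"
begin

lemma primitive_rep: "c \<in> A \<Longrightarrow> primitive (rep c)"
  using A(2) primitive_classes_upto_cases(1) by blast

lemma rep_nonempty: "c \<in> A \<Longrightarrow> rep c \<noteq> []"
  using primitive_rep by (simp add: primitive_def)

lemma finite_orbits: "finite (\<Union>c\<in>A. word_orbit (rep c))"
  using A(1) finite_word_orbit[OF rep_nonempty] by blast

lemma cycles_multiplicity_supp:
  "{u. cycles_multiplicity A m u > 0} \<subseteq> (\<Union>c\<in>A. word_orbit (rep c))"
proof
  fix u assume "u \<in> {u. cycles_multiplicity A m u > 0}"
  then have "cycles_multiplicity A m u \<noteq> 0" by simp
  then obtain c where "c \<in> A" "(if u \<in> word_orbit (rep c) then m c else 0) \<noteq> 0"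
    unfolding cycles_multiplicity_def by (rule sum.not_neutral_contains_not_neutral)
  then show "u \<in> (\<Union>c\<in>A. word_orbit (rep c))" by (auto split: if_splits)
qed

lemma finite_cycles_multiplicity: "finite {u. cycles_multiplicity A m u > 0}"
  by (rule finite_subset[OF cycles_multiplicity_supp finite_orbits])

lemma sum_cycles_multiplicity:
  "(\<Sum>u | cycles_multiplicity A m u > 0. cycles_multiplicity A m u) = (\<Sum>c\<in>A. m c * length (rep c))"
proof -
  let ?U = "\<Union>c\<in>A. word_orbit (rep c)"
  have "(\<Sum>u | cycles_multiplicity A m u > 0. cycles_multiplicity A m u) =
      (\<Sum>u\<in>?U. cycles_multiplicity A m u)"
    by (rule sum.mono_neutral_left[OF finite_orbits cycles_multiplicity_supp]) auto
  also have "\<dots> = (\<Sum>c\<in>A. \<Sum>u\<in>?U. if u \<in> word_orbit (rep c) then m c else 0)"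
    unfolding cycles_multiplicity_def by (rule sum.swap)
  also have "\<dots> = (\<Sum>c\<in>A. m c * length (rep c))"
  proof (rule sum.cong[OF refl])
    fix c assume c: "c \<in> A"
    have "(\<Sum>u\<in>?U. if u \<in> word_orbit (rep c) then m c else 0) = (\<Sum>u\<in>word_orbit (rep c). m c)"
      by (rule sum.mono_neutral_cong_right[OF finite_orbits]) (use c in auto)
    then show "(\<Sum>u\<in>?U. if u \<in> word_orbit (rep c) then m c else 0) = m c * length (rep c)"
      by (simp add: card_word_orbit[OF primitive_rep[OF c]])
  qed
  finally show ?thesis .
qed

lemma prod_cycles_multiplicity:
  fixes p :: "real \<Rightarrow> real"
  shows "(\<Prod>u | cycles_multiplicity A m u > 0. p (u 0) ^ cycles_multiplicity A m u) =
    (\<Prod>c\<in>A. word_weight p (rep c) ^ m c)"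
proof -
  let ?U = "\<Union>c\<in>A. word_orbit (rep c)"
  have "(\<Prod>u | cycles_multiplicity A m u > 0. p (u 0) ^ cycles_multiplicity A m u) =
      (\<Prod>u\<in>?U. p (u 0) ^ cycles_multiplicity A m u)"
    by (rule prod.mono_neutral_left[OF finite_orbits cycles_multiplicity_supp]) auto
  also have "\<dots> = (\<Prod>c\<in>A. \<Prod>u\<in>?U. p (u 0) ^ (if u \<in> word_orbit (rep c) then m c else 0))"
    unfolding cycles_multiplicity_def power_sum by (rule prod.swap)
  also have "\<dots> = (\<Prod>c\<in>A. word_weight p (rep c) ^ m c)"
  proof (rule prod.cong[OF refl])
    fix c assume c: "c \<in> A"
    have "(\<Prod>u\<in>?U. p (u 0) ^ (if u \<in> word_orbit (rep c) then m c else 0)) =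
        (\<Prod>u\<in>word_orbit (rep c). p (u 0) ^ m c)"
      by (rule prod.mono_neutral_cong_right[OF finite_orbits]) (use c in auto)
    also have "\<dots> = word_weight p (rep c) ^ m c"
      unfolding prod_word_orbit[OF primitive_rep[OF c], symmetric] by (rule prod_power_distrib[symmetric])
    finally show "(\<Prod>u\<in>?U. p (u 0) ^ (if u \<in> word_orbit (rep c) then m c else 0)) =
        word_weight p (rep c) ^ m c" .
  qed
  finally show ?thesis .
qed

lemma cycles_multiplicity_rep:
  assumes "c \<in> A"
  shows "cycles_multiplicity A m (periodic_word (rep c)) = m c"
proof -
  have "c' = c" if "c' \<in> A" "periodic_word (rep c) \<in> word_orbit (rep c')" for c'
    using that assms A(2) rep_conj_imp_eq[of c I k c'] by (auto simp: word_orbit_def)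
  then have "cycles_multiplicity A m (periodic_word (rep c)) = (\<Sum>c'\<in>A. if c' = c then m c' else 0)"
    unfolding cycles_multiplicity_def
    by (intro sum.cong) (auto simp: periodic_word_in_orbit)
  then show ?thesis using assms A(1) by simp
qed

lemma cycles_multiplicity_shift:
  "has_period N u \<Longrightarrow> cycles_multiplicity A m (u \<circ> Suc) = cycles_multiplicity A m u"
  unfolding cycles_multiplicity_def by (simp add: shift_in_word_orbit_iff)

text \<open>Both counts are constant on the orbit of each \<open>rep c\<close>, with values
  \<open>m c\<close> and the cycle count; off these orbits the multiplicity is 0.\<close>

lemma cycles_multiplicity_le_iff:
  "(\<forall>u. cycles_multiplicity A m u \<le> itinerary_count n g u) \<longleftrightarrow>
    (\<forall>c\<in>A. m c \<le> cycle_count n g (rep c))"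
proof safe
  fix c assume "\<forall>u. cycles_multiplicity A m u \<le> itinerary_count n g u" "c \<in> A"
  then show "m c \<le> cycle_count n g (rep c)"
    using cycles_multiplicity_rep[of c m]
    by (metis cycle_count_eq_itinerary_count primitive_rep)
next
  fix u assume le: "\<forall>c\<in>A. m c \<le> cycle_count n g (rep c)"
  show "cycles_multiplicity A m u \<le> itinerary_count n g u"
  proof (cases "cycles_multiplicity A m u = 0")
    case False
    then obtain c where c: "c \<in> A" "u \<in> word_orbit (rep c)"
      using cycles_multiplicity_supp[of m] by auto
    have "cycles_multiplicity A m u = m c"
      using word_orbit_invariant[of "cycles_multiplicity A m", OF cycles_multiplicity_shift
          rep_nonempty[OF c(1)] c(2)] cycles_multiplicity_rep[OF c(1)] by simp
    moreover have "itinerary_count n g u = cycle_count n g (rep c)"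
      using word_orbit_invariant[of "itinerary_count n g", OF itinerary_count_shift
          rep_nonempty[OF c(1)] c(2)] cycle_count_eq_itinerary_count[OF primitive_rep[OF c(1)]] by simp
    ultimately show ?thesis using le c(1) by simp
  qed simp
qed

text \<open>The cycles of class \<open>c\<close> are counted by the points with itinerary
  \<open>periodic_word (rep c)\<close>. These words differ from class to class, and there are
  \<open>n\<close> points in all.\<close>

lemma sum_cycle_count_le: "(\<Sum>c\<in>A. cycle_count n g (rep c)) \<le> n"
proof -
  let ?P = "(\<lambda>c. periodic_word (rep c)) ` A"
  have "inj_on (\<lambda>c. periodic_word (rep c)) A"
    using A(2) rep_conj_imp_eq[where i = 0 and I = I and k = k] by (fastforce simp: inj_on_def)
  then have "(\<Sum>c\<in>A. cycle_count n g (rep c)) = sum (itinerary_count n g) ?P"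
    by (simp add: sum.reindex cycle_count_eq_itinerary_count[OF primitive_rep] cong: sum.cong)
  also have "\<dots> \<le> sum (itinerary_count n g) (?P \<union> itinerary n g ` {1..n})"
    using A(1) by (intro sum_mono2) auto
  also have "\<dots> = n" using A(1) by (intro sum_itinerary_count) auto
  finally show ?thesis .
qed

end

text \<open>Each occurring class uses up a point, so \<open>n + 1\<close> classes cannot occur
  together.\<close>

lemma finite_cycle_count:
  "finite {c \<in> primitive_classes_upto I k. cycle_count n g (rep c) \<noteq> 0}" (is "finite ?S")
proof (rule ccontr)
  assume "infinite ?S"
  then obtain A where A: "A \<subseteq> ?S" "finite A" "card A = Suc n"
    using infinite_arbitrarily_large by blast
  have "card A \<le> (\<Sum>c\<in>A. cycle_count n g (rep c))"
    using A(1) sum_mono[of A "\<lambda>_. 1" "\<lambda>c. cycle_count n g (rep c)"] by fastforce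
  also have "\<dots> \<le> n" using A by (intro sum_cycle_count_le) auto
  finally show False using A(3) by simp
qed

context random_words
begin

text \<open>The sum is the number of points on the prescribed cycles. Once at least one further
  point remains, the joint tail is exactly that of independent geometric variables.\<close>

theorem prob_cycle_count_ge:
  assumes "finite A" "A \<subseteq> primitive_classes_upto I k" "n > (\<Sum>c\<in>A. m c * length (rep c))"
  shows "measure (M n) {\<omega> \<in> space (M n). \<forall>c\<in>A. m c \<le> cycle_count n (\<lambda>j. G n j \<omega>) (rep c)} =
    (\<Prod>c\<in>A. word_weight p (rep c) ^ m c)"
proof -
  let ?\<mu> = "cycles_multiplicity A m"
  have "u 0 \<in> I \<and> (\<exists>N. has_period N u)" if u: "?\<mu> u > 0" for u
  proof -
    obtain c where c: "c \<in> A" "u \<in> word_orbit (rep c)"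
      using cycles_multiplicity_supp[OF assms(1,2)] u by blast
    have "rep c \<noteq> []" using rep_nonempty[OF assms(1,2) c(1)] .
    then show ?thesis
      using word_orbit_values[of "rep c" u 0] has_period_word_orbit[of "rep c" u] c
        primitive_classes_upto_cases(2)[of c I k] assms(2) by blast
  qed
  then have "measure (M n) {\<omega> \<in> space (M n). \<forall>u. ?\<mu> u \<le> itinerary_count n (\<lambda>j. G n j \<omega>) u} =
      (\<Prod>u | ?\<mu> u > 0. p (u 0) ^ ?\<mu> u)"
    using assms(3) sum_cycles_multiplicity[OF assms(1,2)] cycles_multiplicity_shift[OF assms(1,2)]
    by (intro prob_itinerary_count_ge finite_cycles_multiplicity[OF assms(1,2)]) auto
  then show ?thesis
    unfolding cycles_multiplicity_le_iff[OF assms(1,2)] prod_cycles_multiplicity[OF assms(1,2)] .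
qed

text \<open>The cycle count factors through \<open>word n\<close>, whose values lie in a countable
  discrete space, where every function is measurable.\<close>

lemma cycle_count_measurable:
  assumes "n \<ge> 1"
  shows "(\<lambda>\<omega>. h (cycle_count n (\<lambda>j. G n j \<omega>) w)) \<in> M n \<rightarrow>\<^sub>M count_space UNIV"
proof -
  have "cycle_count n (word n \<omega>) w = cycle_count n (\<lambda>j. G n j \<omega>) w" for \<omega>
  proof -
    have *: "map (word n \<omega>) xs = map (\<lambda>j. G n j \<omega>) xs" if "writes_cycle n \<sigma> xs" for xs \<sigma>
      using that by (auto simp: writes_cycle_def word_def)
    have "std n (word n \<omega>) = std n (\<lambda>j. G n j \<omega>)" by (rule std_cong) (simp add: word_def)
    then show ?thesis unfolding cycle_count_def using * by (metis (no_types, lifting))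
  qed
  moreover have "(\<lambda>\<omega>. h (cycle_count n (word n \<omega>) w)) \<in> M n \<rightarrow>\<^sub>M count_space UNIV"
    by (rule measurable_compose[OF word_measurable[OF assms]]) simp
  ultimately show ?thesis by simp
qed

end

section \<open>Convergence to a discrete law\<close>

lemma countable_finite_exhaustion:
  assumes "countable J"
  obtains F :: "nat \<Rightarrow> 'a set" where "incseq F" "\<And>i. finite (F i)" "(\<Union>i. F i) = J"
proof (cases "J = {}")
  case True
  then show thesis using that[of "\<lambda>_. {}"] by (simp add: incseq_def)
next
  case False
  show thesis
  proof (rule that[of "\<lambda>i. from_nat_into J ` {..<i}"])
    show "(\<Union>i. from_nat_into J ` {..<i}) = J"
      using range_from_nat_into[OF False assms] by auto
  qed (auto simp: incseq_def)
qed

text \<open>Countable subadditivity for unordered sums, obtained from the finite case along an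
  exhaustion by finite sets.\<close>

lemma (in finite_measure) measure_UN_le_infsum:
  assumes "countable J" "\<And>c. c \<in> J \<Longrightarrow> X c \<in> sets M" "\<And>c. c \<in> J \<Longrightarrow> measure M (X c) \<le> q c"
    and "q summable_on J"
  shows "measure M (\<Union>c\<in>J. X c) \<le> infsum q J"
proof -
  obtain F where F: "incseq F" "\<And>i. finite (F i)" "(\<Union>i. F i) = J"
    using countable_finite_exhaustion[OF assms(1)] by blast
  have sub: "F i \<subseteq> J" for i using F(3) by blast
  have q: "q c \<ge> 0" if "c \<in> J" for c using assms(3)[OF that] measure_nonneg order.trans by blast
  have "measure M (\<Union>c\<in>F i. X c) \<le> infsum q J" for i
  proof -
    have "measure M (\<Union>c\<in>F i. X c) \<le> (\<Sum>c\<in>F i. measure M (X c))"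
      using F(2) assms(2) sub by (intro finite_measure_subadditive_finite) auto
    also have "\<dots> \<le> sum q (F i)" using assms(3) sub by (intro sum_mono) auto
    also have "\<dots> \<le> infsum q J"
      using F(2) sub q assms(4) by (intro finite_sum_le_infsum) auto
    finally show ?thesis .
  qed
  moreover have "(\<lambda>i. measure M (\<Union>c\<in>F i. X c)) \<longlonglongrightarrow> measure M (\<Union>i. \<Union>c\<in>F i. X c)"
  proof (rule finite_Lim_measure_incseq)
    show "range (\<lambda>i. \<Union>c\<in>F i. X c) \<subseteq> sets M"
      using F(2) sub assms(2) by (auto intro!: sets.finite_UN)
    show "incseq (\<lambda>i. \<Union>c\<in>F i. X c)" using F(1) by (fastforce simp: incseq_def)
  qed
  moreover have "(\<Union>i. \<Union>c\<in>F i. X c) = (\<Union>c\<in>J. X c)" using F(3) by blast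
  ultimately show ?thesis by (intro LIMSEQ_le_const2) auto
qed

lemma infsum_outside_finite_small:
  fixes q :: "'a \<Rightarrow> real"
  assumes "q summable_on S" "e > 0"
  obtains F where "finite F" "F \<subseteq> S" "\<And>A. finite A \<Longrightarrow> F \<subseteq> A \<Longrightarrow> A \<subseteq> S \<Longrightarrow> \<bar>infsum q (S - A)\<bar> < e"
proof -
  have "(q has_sum infsum q S) S" using assms(1) by simp
  then have "eventually (\<lambda>A. dist (sum q A) (infsum q S) < e) (finite_subsets_at_top S)"
    using assms(2) unfolding has_sum_def tendsto_iff by blast
  then obtain F where F: "finite F" "F \<subseteq> S"
    and close: "\<forall>A. finite A \<and> F \<subseteq> A \<and> A \<subseteq> S \<longrightarrow> dist (sum q A) (infsum q S) < e"
    unfolding eventually_finite_subsets_at_top by (elim exE conjE) (rule that)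
  show thesis
  proof (rule that[OF F])
    fix A assume A: "finite A" "F \<subseteq> A" "A \<subseteq> S"
    have "infsum q (S - A) = infsum q S - infsum q A"
      using A assms(1) by (intro infsum_Diff) auto
    moreover have "infsum q A = sum q A" using A(1) by (rule infsum_finite)
    moreover have "dist (sum q A) (infsum q S) < e" using close A by blast
    ultimately show "\<bar>infsum q (S - A)\<bar> < e" by (simp add: dist_real_def abs_minus_commute)
  qed
qed

lemma integral_approx_finite:
  fixes f :: "'a \<Rightarrow> real"
  assumes "prob_space \<mu>" "f \<in> borel_measurable \<mu>" "\<And>x. \<bar>f x\<bar> \<le> C"
    and T: "finite T" "\<And>x. x \<in> T \<Longrightarrow> {x} \<in> sets \<mu>"
  shows "\<bar>(\<integral>x. f x \<partial>\<mu>) - (\<Sum>x\<in>T. f x * measure \<mu> {x})\<bar> \<le> C * (1 - (\<Sum>x\<in>T. measure \<mu> {x}))"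
proof -
  interpret prob_space \<mu> by fact
  have intf: "integrable \<mu> f" using assms(2,3) by (intro integrable_const_bound[of _ C]) auto
  have T_sets: "T \<in> sets \<mu>"
    using T sets.finite_UN[of T "\<lambda>x. {x}" \<mu>] by simp
  have mT: "measure \<mu> T = (\<Sum>x\<in>T. measure \<mu> {x})"
    using finite_measure_eq_sum_singleton[OF T] by simp
  have "(\<integral>x. f x * indicator T x \<partial>\<mu>) = (\<integral>x. (\<Sum>y\<in>T. f y * indicator {y} x) \<partial>\<mu>)"
    using T(1) by (intro Bochner_Integration.integral_cong) (auto simp: indicator_def if_distrib cong: if_cong)
  also have "\<dots> = (\<Sum>y\<in>T. f y * measure \<mu> {y})"
    using T(2) by (subst Bochner_Integration.integral_sum) (auto simp: emeasure_eq_measure)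
  finally have 1: "(\<integral>x. f x * indicator T x \<partial>\<mu>) = (\<Sum>y\<in>T. f y * measure \<mu> {y})" .
  have "(\<integral>x. f x \<partial>\<mu>) - (\<integral>x. f x * indicator T x \<partial>\<mu>) = (\<integral>x. f x - f x * indicator T x \<partial>\<mu>)"
    using intf T_sets by (intro Bochner_Integration.integral_diff[symmetric] integrable_real_mult_indicator)
  also have "\<bar>\<dots>\<bar> \<le> (\<integral>x. \<bar>f x - f x * indicator T x\<bar> \<partial>\<mu>)" by (rule integral_abs_bound)
  also have "\<dots> \<le> (\<integral>x. C * indicator (space \<mu> - T) x \<partial>\<mu>)"
  proof (rule integral_mono)
    show "integrable \<mu> (\<lambda>x. \<bar>f x - f x * indicator T x\<bar>)"
      using intf T_sets
      by (intro integrable_abs Bochner_Integration.integrable_diff integrable_real_mult_indicator)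
    show "integrable \<mu> (\<lambda>x. C * indicator (space \<mu> - T) x)"
      using T_sets by (auto simp: emeasure_eq_measure)
  qed (use assms(3) in \<open>auto simp: indicator_def\<close>)
  also have "\<dots> = C * (1 - measure \<mu> T)" using T_sets by (simp add: prob_compl)
  finally show ?thesis unfolding 1 mT .
qed

text \<open>Scheffe's principle for an atomic limit: finitely many atoms carry almost all the mass
  of \<open>\<nu>\<close> and therefore, by convergence of their masses, of \<open>\<mu> n\<close>
  for large \<open>n\<close>.\<close>

lemma integral_tendsto_discrete:
  fixes f :: "'a \<Rightarrow> real" and \<mu> :: "nat \<Rightarrow> 'a measure"
  assumes "\<And>n. n \<ge> n0 \<Longrightarrow> prob_space (\<mu> n)" "\<And>n. n \<ge> n0 \<Longrightarrow> sets (\<mu> n) = sets \<nu>"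
    and "prob_space \<nu>"
    and F: "countable F" "\<And>x. x \<in> F \<Longrightarrow> {x} \<in> sets \<nu>" "measure \<nu> F = 1"
    and lim: "\<And>x. x \<in> F \<Longrightarrow> (\<lambda>n. measure (\<mu> n) {x}) \<longlonglongrightarrow> measure \<nu> {x}"
    and f: "f \<in> borel_measurable \<nu>" "\<And>x. \<bar>f x\<bar> \<le> C"
  shows "(\<lambda>n. \<integral>x. f x \<partial>\<mu> n) \<longlonglongrightarrow> (\<integral>x. f x \<partial>\<nu>)"
proof (rule tendstoI)
  fix e :: real assume e: "e > 0"
  interpret \<nu>: prob_space \<nu> by fact
  have C: "C \<ge> 0" using f(2) abs_ge_zero order.trans by blast
  obtain A where A: "incseq A" "\<And>i. finite (A i)" "(\<Union>i. A i) = F"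
    using countable_finite_exhaustion[OF F(1)] by blast
  have A_sets: "A i \<in> sets \<nu>" for i
    using A(2,3) F(2) sets.finite_UN[of "A i" "\<lambda>x. {x}" \<nu>] by (simp add: UN_subset_iff subset_iff) blast
  have "(\<lambda>i. measure \<nu> (A i)) \<longlonglongrightarrow> measure \<nu> (\<Union>i. A i)"
    using A_sets A(1) by (intro \<nu>.finite_Lim_measure_incseq) auto
  then have "(\<lambda>i. 2 * C * (1 - measure \<nu> (A i))) \<longlonglongrightarrow> 2 * C * (1 - 1)"
    unfolding A(3) F(3) by (intro tendsto_intros)
  then have "eventually (\<lambda>i. 2 * C * (1 - measure \<nu> (A i)) < e) sequentially"
    using e by (auto dest: order_tendstoD)
  then obtain i where i: "2 * C * (1 - measure \<nu> (A i)) < e" by (auto simp: eventually_sequentially)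
  define T where "T = A i"
  have T: "finite T" "T \<subseteq> F" using A by (auto simp: T_def)
  have mT: "measure \<nu> T = (\<Sum>x\<in>T. measure \<nu> {x})"
    using \<nu>.finite_measure_eq_sum_singleton[OF T(1)] T(2) F(2) by auto
  \<comment> \<open>\<open>R n\<close> bounds the difference of the integrals: the error on the
    atoms in \<open>T\<close> plus the two masses outside \<open>T\<close>. In the limit only
    \<open>2 * C * (1 - measure \<nu> T)\<close> is left, the quantity made small by the choice of
    \<open>i\<close>.\<close>
  define R where "R n = \<bar>\<Sum>x\<in>T. f x * (measure (\<mu> n) {x} - measure \<nu> {x})\<bar> +
      C * (1 - (\<Sum>x\<in>T. measure (\<mu> n) {x})) + C * (1 - (\<Sum>x\<in>T. measure \<nu> {x}))" for n
  have "R \<longlonglongrightarrow> \<bar>\<Sum>x\<in>T. f x * (measure \<nu> {x} - measure \<nu> {x})\<bar> +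
      C * (1 - (\<Sum>x\<in>T. measure \<nu> {x})) + C * (1 - (\<Sum>x\<in>T. measure \<nu> {x}))"
    unfolding R_def using lim T(2) by (intro tendsto_intros) auto
  then have "R \<longlonglongrightarrow> 2 * C * (1 - measure \<nu> T)" unfolding mT by (simp add: algebra_simps)
  then have "eventually (\<lambda>n. R n < e) sequentially" using i unfolding T_def by (rule order_tendstoD)
  moreover have "eventually (\<lambda>n. n \<ge> n0) sequentially" by (rule eventually_ge_at_top)
  ultimately show "eventually (\<lambda>n. dist (\<integral>x. f x \<partial>\<mu> n) (\<integral>x. f x \<partial>\<nu>) < e) sequentially"
  proof eventually_elim
    case (elim n)
    have f_n: "f \<in> borel_measurable (\<mu> n)"
      using f(1) measurable_cong_sets[OF assms(2)[OF elim(2)] refl] by blast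
    have "\<bar>(\<integral>x. f x \<partial>\<mu> n) - (\<Sum>x\<in>T. f x * measure (\<mu> n) {x})\<bar> \<le> C * (1 - (\<Sum>x\<in>T. measure (\<mu> n) {x}))"
      using assms(1,2)[OF elim(2)] f_n f(2) T F(2) by (intro integral_approx_finite) auto
    moreover have "\<bar>(\<integral>x. f x \<partial>\<nu>) - (\<Sum>x\<in>T. f x * measure \<nu> {x})\<bar> \<le> C * (1 - (\<Sum>x\<in>T. measure \<nu> {x}))"
      using assms(3) f T F(2) by (intro integral_approx_finite) auto
    moreover have "(\<Sum>x\<in>T. f x * (measure (\<mu> n) {x} - measure \<nu> {x})) =
        (\<Sum>x\<in>T. f x * measure (\<mu> n) {x}) - (\<Sum>x\<in>T. f x * measure \<nu> {x})"
      by (simp add: right_diff_distrib sum_subtractf)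
    ultimately show ?case using elim(1) unfolding R_def dist_real_def by linarith
  qed
qed

section \<open>The Borel sets of the sequence space\<close>

text \<open>Serves twice for countable \<open>S\<close>: with \<open>\<nat>\<close> it is the
  countable set that carries the laws, with \<open>\<rat>\<close> a countable dense subset of
  \<open>ell1 S\<close>.\<close>

definition fin_supp :: "'a set \<Rightarrow> real set \<Rightarrow> ('a \<Rightarrow> real) set" where
  "fin_supp S R = {x \<in> S \<rightarrow>\<^sub>E R. finite {c \<in> S. x c \<noteq> 0}}"

lemma countable_fin_supp:
  assumes "countable S" "countable R"
  shows "countable (fin_supp S R)"
proof -
  have "fin_supp S R \<subseteq> (\<Union>A\<in>{A. finite A \<and> A \<subseteq> S}. (\<lambda>y. \<lambda>c\<in>S. if c \<in> A then y c else 0) ` (A \<rightarrow>\<^sub>E R))"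
  proof
    fix x assume x: "x \<in> fin_supp S R"
    let ?A = "{c \<in> S. x c \<noteq> 0}"
    have "x = (\<lambda>c\<in>S. if c \<in> ?A then restrict x ?A c else 0)"
      using x by (intro extensionalityI[of _ S]) (auto simp: fin_supp_def PiE_def)
    moreover have "restrict x ?A \<in> ?A \<rightarrow>\<^sub>E R" using x by (auto simp: fin_supp_def)
    ultimately show "x \<in> (\<Union>A\<in>{A. finite A \<and> A \<subseteq> S}. (\<lambda>y. \<lambda>c\<in>S. if c \<in> A then y c else 0) ` (A \<rightarrow>\<^sub>E R))"
      using x by (intro UN_I[of ?A] image_eqI[of _ _ "restrict x ?A"]) (auto simp: fin_supp_def)
  qed
  moreover have "countable \<dots>"
    using assms by (intro countable_UN countable_Collect_finite_subset countable_image countable_PiE) auto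
  ultimately show ?thesis by (rule countable_subset)
qed

lemma fin_supp_subset_ell1: "fin_supp S R \<subseteq> ell1 S"
proof
  fix x assume x: "x \<in> fin_supp S R"
  have "(\<lambda>c. \<bar>x c\<bar>) summable_on {c \<in> S. x c \<noteq> 0}" using x by (auto simp: fin_supp_def)
  then have "(\<lambda>c. \<bar>x c\<bar>) summable_on S"
    by (rule summable_on_cong_neutral[THEN iffD1, rotated -1]) auto
  then show "x \<in> ell1 S" using x by (auto simp: ell1_def fin_supp_def PiE_def)
qed

abbreviation real_PiM :: "'a set \<Rightarrow> ('a \<Rightarrow> real) measure" where
  "real_PiM S \<equiv> PiM S (\<lambda>_. borel)"

lemma singleton_in_sets_PiM:
  assumes "countable S" "x \<in> extensional S"
  shows "{x} \<in> sets (real_PiM S)"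
proof -
  have "{x} = Pi\<^sub>E S (\<lambda>c. {x c})" using assms(2) by (simp add: PiE_singleton)
  also have "\<dots> \<in> sets (real_PiM S)" using assms(1) by (intro sets_PiM_I_countable) auto
  finally show ?thesis .
qed

text \<open>The bound is tested on the finite subsets of \<open>S\<close>, of which there are
  countably many. Taking \<open>y = 0\<close> leads to \<open>ell1 S\<close> itself, taking
  \<open>y\<close> in \<open>ell1 S\<close> to closed balls.\<close>

lemma ell1_dist_le_measurable:
  assumes "countable S"
  shows "{x \<in> space (real_PiM S). \<forall>A\<in>{A. finite A \<and> A \<subseteq> S}. (\<Sum>c\<in>A. \<bar>y c - x c\<bar>) \<le> r} \<in> sets (real_PiM S)"
proof -
  let ?Z = "\<lambda>A. {x \<in> space (real_PiM S). (\<Sum>c\<in>A. \<bar>y c - x c\<bar>) \<le> r}"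
  have "?Z A \<in> sets (real_PiM S)" if A: "A \<subseteq> S" for A
  proof -
    have [measurable]: "(\<lambda>x. x c) \<in> borel_measurable (real_PiM S)" if "c \<in> A" for c
      using that A by (intro measurable_component_singleton) auto
    show ?thesis by measurable
  qed
  then have "(\<Inter>A\<in>{A. finite A \<and> A \<subseteq> S}. ?Z A) \<in> sets (real_PiM S)"
    using countable_Collect_finite_subset[OF assms] by (intro sets.countable_INT') auto
  also have "(\<Inter>A\<in>{A. finite A \<and> A \<subseteq> S}. ?Z A) =
      {x \<in> space (real_PiM S). \<forall>A\<in>{A. finite A \<and> A \<subseteq> S}. (\<Sum>c\<in>A. \<bar>y c - x c\<bar>) \<le> r}"
    by auto
  finally show ?thesis .
qed

lemma summable_on_iff_bounded:
  fixes q :: "'a \<Rightarrow> real"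
  assumes "\<And>c. c \<in> S \<Longrightarrow> q c \<ge> 0"
  shows "q summable_on S \<longleftrightarrow> (\<exists>B::nat. \<forall>A\<in>{A. finite A \<and> A \<subseteq> S}. sum q A \<le> real B)"
proof
  assume q: "q summable_on S"
  obtain B :: nat where "infsum q S \<le> real B" using real_arch_simple by blast
  then show "\<exists>B::nat. \<forall>A\<in>{A. finite A \<and> A \<subseteq> S}. sum q A \<le> real B"
    using finite_sum_le_infsum[OF q] assms by (metis (no_types, lifting) Diff_iff mem_Collect_eq order.trans)
next
  assume "\<exists>B::nat. \<forall>A\<in>{A. finite A \<and> A \<subseteq> S}. sum q A \<le> real B"
  then obtain B :: nat where "\<forall>A\<in>{A. finite A \<and> A \<subseteq> S}. sum q A \<le> real B" by blast
  then show "q summable_on S"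
    using assms by (intro nonneg_bdd_above_summable_on) (auto simp: bdd_above_def)
qed

text \<open>The partial sums of a summable family are bounded by some natural number, so the space
  is a countable union of measurable sets.\<close>

lemma ell1_measurable:
  assumes "countable S"
  shows "ell1 S \<in> sets (real_PiM S)"
proof -
  have "ell1 S = (\<Union>B::nat. {x \<in> space (real_PiM S). \<forall>A\<in>{A. finite A \<and> A \<subseteq> S}. (\<Sum>c\<in>A. \<bar>0 - x c\<bar>) \<le> real B})"
    unfolding ell1_def by (auto simp: summable_on_iff_bounded space_PiM PiE_def)
  also have "\<dots> \<in> sets (real_PiM S)"
    using ell1_dist_le_measurable[OF assms, of "\<lambda>_. 0"] by (intro sets.countable_UN) auto
  finally show ?thesis .
qed

lemma ell1_dist_le_iff:
  assumes "x \<in> ell1 S" "y \<in> ell1 S"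
  shows "ell1_dist S y x \<le> r \<longleftrightarrow> (\<forall>A\<in>{A. finite A \<and> A \<subseteq> S}. (\<Sum>c\<in>A. \<bar>y c - x c\<bar>) \<le> r)"
proof
  assume "ell1_dist S y x \<le> r"
  then show "\<forall>A\<in>{A. finite A \<and> A \<subseteq> S}. (\<Sum>c\<in>A. \<bar>y c - x c\<bar>) \<le> r"
    unfolding ell1_dist_def
    using finite_sum_le_infsum[OF ell1_diff_summable[OF assms(2,1)]] by fastforce
next
  assume "\<forall>A\<in>{A. finite A \<and> A \<subseteq> S}. (\<Sum>c\<in>A. \<bar>y c - x c\<bar>) \<le> r"
  then show "ell1_dist S y x \<le> r"
    unfolding ell1_dist_def
    by (intro infsum_le_finite_sums ell1_diff_summable assms) auto
qed

lemma fin_supp_dense: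
  assumes x: "x \<in> ell1 S" and e: "e > 0"
  obtains d where "d \<in> fin_supp S \<rat>" "ell1_dist S d x < e"
proof -
  have sx: "(\<lambda>c. \<bar>x c\<bar>) summable_on S" using x by (simp add: ell1_def)
  obtain A where A: "finite A" "A \<subseteq> S"
    and small: "\<And>B. finite B \<Longrightarrow> A \<subseteq> B \<Longrightarrow> B \<subseteq> S \<Longrightarrow> \<bar>\<Sum>\<^sub>\<infinity>c\<in>S - B. \<bar>x c\<bar>\<bar> < e / 2"
    by (rule infsum_outside_finite_small[OF sx half_gt_zero[OF e]]) (rule that)
  note small = small[OF A(1) order_refl A(2)]
  \<comment> \<open>The \<open>card A\<close> coordinates in \<open>A\<close> are moved by less than
    \<open>\<delta>\<close> each, together by at most \<open>e / 2\<close>; the \<open>+ 1\<close>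
    covers empty \<open>A\<close>.\<close>
  define \<delta> where "\<delta> = e / (2 * (real (card A) + 1))"
  have \<delta>: "\<delta> > 0" using e by (simp add: \<delta>_def)
  have "\<exists>q. q \<in> \<rat> \<and> \<bar>q - x c\<bar> < \<delta>" for c
  proof -
    obtain q where "q \<in> \<rat>" "x c < q" "q < x c + \<delta>" using Rats_dense_in_real[of "x c" "x c + \<delta>"] \<delta> by auto
    then show ?thesis by (intro exI[of _ q]) auto
  qed
  then obtain q where q: "\<And>c. q c \<in> \<rat>" "\<And>c. \<bar>q c - x c\<bar> < \<delta>" by metis
  define d where "d = (\<lambda>c\<in>S. if c \<in> A then q c else 0)"
  have "finite {c \<in> S. d c \<noteq> 0}"
    by (rule finite_subset[OF _ A(1)]) (auto simp: d_def split: if_splits)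
  then have d: "d \<in> fin_supp S \<rat>" using q(1) by (auto simp: fin_supp_def d_def)
  have sd: "(\<lambda>c. \<bar>d c - x c\<bar>) summable_on S"
    using ell1_diff_summable[of d S x] fin_supp_subset_ell1 d x by blast
  have "ell1_dist S d x = (\<Sum>\<^sub>\<infinity>c\<in>A. \<bar>d c - x c\<bar>) + (\<Sum>\<^sub>\<infinity>c\<in>S - A. \<bar>d c - x c\<bar>)"
    unfolding ell1_dist_def using infsum_Un_disjoint[of "\<lambda>c. \<bar>d c - x c\<bar>" A "S - A"]
      summable_on_subset_banach[OF sd] A(1,2) by (simp add: Un_absorb1)
  also have "(\<Sum>\<^sub>\<infinity>c\<in>S - A. \<bar>d c - x c\<bar>) = (\<Sum>\<^sub>\<infinity>c\<in>S - A. \<bar>x c\<bar>)"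
    by (rule infsum_cong) (auto simp: d_def)
  also have "(\<Sum>\<^sub>\<infinity>c\<in>A. \<bar>d c - x c\<bar>) = (\<Sum>c\<in>A. \<bar>q c - x c\<bar>)"
    using A(1,2) by (auto simp: d_def intro!: sum.cong)
  also have "\<dots> \<le> (\<Sum>c\<in>A. \<delta>)" using q(2) by (intro sum_mono less_imp_le)
  also have "\<dots> = e / 2 * (real (card A) / (real (card A) + 1))" by (simp add: \<delta>_def)
  also have "\<dots> \<le> e / 2 * 1" using e by (intro mult_left_mono) auto
  finally have "ell1_dist S d x < e" using small by linarith
  with d show thesis by (rule that)
qed

lemma borel_of_topology_simps:
  "space (borel_of_topology X) = topspace X"
  "openin X U \<Longrightarrow> U \<in> sets (borel_of_topology X)"
  unfolding borel_of_topology_def using openin_subset[of X]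
  by (auto simp: space_measure_of_conv sets_measure_of_conv)

text \<open>By separability an open set is a countable union of closed balls, and these are
  measurable in the product. Conversely, the coordinates are continuous for the \<open>ell1\<close>
  distance.\<close>

theorem sets_borel_ell1:
  assumes S: "countable S"
  shows "sets (borel_of_topology (ell1_topology S)) = sets (restrict_space (real_PiM S) (ell1 S))"
proof (rule antisym)
  let ?R = "restrict_space (real_PiM S) (ell1 S)"
  interpret Metric_space "ell1 S" "ell1_dist S" by (rule Metric_space_ell1)
  have sp: "space ?R = ell1 S"
    using sets.sets_into_space[OF ell1_measurable[OF S]] by (auto simp: space_restrict_space)
  have ball: "mcball d r \<in> sets ?R" if "d \<in> ell1 S" for d r
  proof -
    have "mcball d r = {x \<in> space (real_PiM S). \<forall>A\<in>{A. finite A \<and> A \<subseteq> S}. (\<Sum>c\<in>A. \<bar>d c - x c\<bar>) \<le> r} \<inter> ell1 S"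
      using that ell1_dist_le_iff[OF _ that] sets.sets_into_space[OF ell1_measurable[OF S]] by auto
    also have "\<dots> \<in> sets (real_PiM S)"
      using ell1_dist_le_measurable[OF S] ell1_measurable[OF S] by (rule sets.Int)
    finally have "mcball d r \<in> sets (real_PiM S)" .
    then show ?thesis
      using ell1_measurable[OF S] mcball_subset_mspace
      by (subst sets_restrict_space_iff) (auto intro: sets.Int)
  qed
  have open_sets: "U \<in> sets ?R" if U: "openin (ell1_topology S) U" for U
  proof -
    have sub: "U \<subseteq> ell1 S" and op: "\<And>x. x \<in> U \<Longrightarrow> \<exists>r>0. mball x r \<subseteq> U"
      using U unfolding ell1_topology_def openin_mtopology by auto
    define Q where "Q = {(d, r). d \<in> fin_supp S \<rat> \<and> r \<in> \<rat> \<and> mcball d r \<subseteq> U}"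
    have "Q \<subseteq> fin_supp S \<rat> \<times> \<rat>" by (auto simp: Q_def)
    then have "countable Q"
      using countable_fin_supp[OF S countable_rat] countable_rat by (meson countable_SIGMA countable_subset)
    have "x \<in> (\<Union>(d, r)\<in>Q. mcball d r)" if x: "x \<in> U" for x
    proof -
      obtain r where r: "r > 0" "mball x r \<subseteq> U" using op[OF x] by blast
      \<comment> \<open>A centre at distance less than \<open>s < r / 2\<close> from
        \<open>x\<close> keeps the ball of radius \<open>s\<close> around it inside the ball of
        radius \<open>r\<close> around \<open>x\<close>.\<close>
      obtain s where s: "s \<in> \<rat>" "0 < s" "s < r / 2" using Rats_dense_in_real[of 0 "r / 2"] r(1) by auto
      obtain d where d: "d \<in> fin_supp S \<rat>" "ell1_dist S d x < s"
        using fin_supp_dense[of x S s] x sub s(2) by blast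
      have dE: "d \<in> ell1 S" using d(1) fin_supp_subset_ell1 by blast
      have "mcball d s \<subseteq> U"
      proof
        fix y assume y: "y \<in> mcball d s"
        have "ell1_dist S x y \<le> ell1_dist S x d + ell1_dist S d y"
          using y x sub dE by (intro triangle) auto
        also have "\<dots> < r" using y d(2) s(3) commute[of x d] by auto
        finally have "y \<in> mball x r" using y x sub by auto
        then show "y \<in> U" using r(2) by blast
      qed
      then have "(d, s) \<in> Q" using d(1) s(1) by (simp add: Q_def)
      moreover have "x \<in> mcball d s" using d(2) dE x sub by auto
      ultimately show ?thesis by blast
    qed
    then have "U = (\<Union>(d, r)\<in>Q. mcball d r)" by (auto simp: Q_def)
    also have "\<dots> \<in> sets ?R"
    proof (rule sets.countable_UN'[OF \<open>countable Q\<close>], rule image_subsetI)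
      fix z assume "z \<in> Q"
      then obtain d r where "z = (d, r)" "d \<in> ell1 S"
        using fin_supp_subset_ell1 unfolding Q_def by blast
      then show "(case z of (d, r) \<Rightarrow> mcball d r) \<in> sets ?R" using ball by simp
    qed
    finally show ?thesis .
  qed
  have "{U. openin (ell1_topology S) U} \<subseteq> Pow (ell1 S)"
    using openin_subset[of "ell1_topology S"] by auto
  then have "sets (borel_of_topology (ell1_topology S)) =
      sigma_sets (ell1 S) {U. openin (ell1_topology S) U}"
    unfolding borel_of_topology_def topspace_ell1 by (rule sets_measure_of)
  moreover have "sigma_sets (space ?R) {U. openin (ell1_topology S) U} \<subseteq> sets ?R"
    using open_sets by (intro sets.sigma_sets_subset) blast
  ultimately show "sets (borel_of_topology (ell1_topology S)) \<subseteq> sets ?R"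
    unfolding sp by simp
  let ?B = "borel_of_topology (ell1_topology S)"
  have spB: "space ?B = ell1 S" by (simp add: borel_of_topology_simps)
  have "(\<lambda>x. x) \<in> ?B \<rightarrow>\<^sub>M real_PiM S"
  proof (rule measurable_PiM_single')
    fix c assume c: "c \<in> S"
    show "(\<lambda>x. x c) \<in> borel_measurable ?B"
      unfolding borel_measurable_iff_less
    proof
      fix a
      have "openin (ell1_topology S) {x \<in> ell1 S. x c < a}"
        unfolding ell1_topology_def openin_mtopology
      proof (intro conjI allI impI)
        fix x assume "x \<in> {x \<in> ell1 S. x c < a}"
        then have x: "x \<in> ell1 S" "x c < a" by auto
        have "mball x (a - x c) \<subseteq> {x \<in> ell1 S. x c < a}"
        proof
          fix y assume "y \<in> mball x (a - x c)"
          then have y: "y \<in> ell1 S" "ell1_dist S x y < a - x c" by auto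
          \<comment> \<open>A single coordinate difference is a partial sum of the distance.\<close>
          have "(\<Sum>c\<in>{c}. \<bar>x c - y c\<bar>) \<le> ell1_dist S x y"
            using ell1_dist_le_iff[OF y(1) x(1), of "ell1_dist S x y"] c by blast
          then show "y \<in> {x \<in> ell1 S. x c < a}" using y by simp
        qed
        then show "\<exists>r>0. mball x r \<subseteq> {x \<in> ell1 S. x c < a}"
          using x(2) by (intro exI[of _ "a - x c"]) simp
      qed auto
      then show "{x \<in> space ?B. x c < a} \<in> sets ?B"
        unfolding spB by (rule borel_of_topology_simps(2))
    qed
  qed (auto simp: spB ell1_def extensional_def)
  then have "A \<inter> ell1 S \<in> sets ?B" if "A \<in> sets (real_PiM S)" for A
    using measurable_sets[of "\<lambda>x. x" ?B "real_PiM S" A] that by (simp add: spB)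
  then show "sets ?R \<subseteq> sets ?B" unfolding sets_restrict_space by (auto simp: Int_commute)
qed

section \<open>Convergence of the cycle counts\<close>

text \<open>A family that agrees with \<open>x\<close> on \<open>A\<close> but differs from
  \<open>x\<close> has a nonzero coordinate outside \<open>A\<close>, and the union bound applies.
  The same \<open>q\<close> serves the limit law and the laws for all \<open>n > k\<close>, so the
  error does not depend on \<open>n\<close>.\<close>

lemma point_mass_approx:
  assumes "prob_space \<mu>" "sets \<mu> = sets (real_PiM S)" "countable S" "x \<in> extensional S"
    and A: "A \<subseteq> S" "finite A" "\<And>c. c \<in> S - A \<Longrightarrow> x c = 0"
    and q: "\<And>c. c \<in> S - A \<Longrightarrow> measure \<mu> {y \<in> space \<mu>. y c \<noteq> 0} \<le> q c" "q summable_on S"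
  shows "\<bar>measure \<mu> {y \<in> space \<mu>. \<forall>c\<in>A. y c = x c} - measure \<mu> {x}\<bar> \<le> infsum q (S - A)"
proof -
  interpret prob_space \<mu> by fact
  have sp: "space \<mu> = S \<rightarrow>\<^sub>E UNIV" using sets_eq_imp_space_eq[OF assms(2)] by (simp add: space_PiM)
  have comp: "{y \<in> space \<mu>. P (y c)} \<in> sets \<mu>" if "c \<in> S" "{z. P z} \<in> sets borel" for P c
  proof -
    have "(\<lambda>y. y c) \<in> measurable \<mu> borel"
      unfolding measurable_cong_sets[OF assms(2) refl]
      using that(1) by (rule measurable_component_singleton)
    from measurable_sets[OF this that(2)] show ?thesis by (simp add: vimage_def Int_def conj_commute)
  qed
  let ?E = "{y \<in> space \<mu>. \<forall>c\<in>A. y c = x c}" and ?U = "\<Union>c\<in>S - A. {y \<in> space \<mu>. y c \<noteq> 0}"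
  have x: "{x} \<in> sets \<mu>" using singleton_in_sets_PiM[OF assms(3,4)] assms(2) by simp
  have E: "?E \<in> sets \<mu>"
    using A comp[of _ "\<lambda>z. z = x _"] by (intro sets.sets_Collect_finite_All) auto
  have nz: "{y \<in> space \<mu>. y c \<noteq> 0} \<in> sets \<mu>" if "c \<in> S - A" for c
    using that comp[of c "\<lambda>z. z \<noteq> 0"] by (simp add: Collect_neg_eq)
  have U: "?U \<in> sets \<mu>" using nz assms(3) by (intro sets.countable_UN') auto
  have xE: "{x} \<subseteq> ?E" using assms(4) by (auto simp: sp PiE_def)
  have "?E - {x} \<subseteq> ?U"
  proof
    fix y assume y: "y \<in> ?E - {x}"
    have "y \<in> ?U \<or> (\<forall>c\<in>S - A. y c = 0)" using y by auto
    then show "y \<in> ?U"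
    proof
      assume "\<forall>c\<in>S - A. y c = 0"
      then have "y = x"
        using y A(3) assms(4) by (intro extensionalityI[of _ S]) (auto simp: sp PiE_def)
      then show ?thesis using y by simp
    qed
  qed
  then have "measure \<mu> (?E - {x}) \<le> measure \<mu> ?U" using U by (rule finite_measure_mono)
  also have "\<dots> \<le> infsum q (S - A)"
    using assms(3) nz q(1) summable_on_subset_banach[OF q(2)] by (intro measure_UN_le_infsum) auto
  finally show ?thesis
    using finite_measure_Diff[OF E x xE] finite_measure_mono[OF xE E] by simp
qed

lemma word_weight_bounds:
  assumes "\<And>i. i \<in> set w \<Longrightarrow> 0 \<le> p i \<and> p i < 1" "w \<noteq> []"
  shows "0 \<le> word_weight p w \<and> word_weight p w < 1"
proof -
  have *: "0 \<le> word_weight p w \<and> word_weight p w \<le> 1" if "\<And>i. i \<in> set w \<Longrightarrow> 0 \<le> p i \<and> p i < 1" for w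
    using that
  proof (induction w)
    case (Cons i w)
    have "0 \<le> p i" "p i \<le> 1" using Cons.prems[of i] by simp_all
    then show ?case
      using Cons.IH Cons.prems by (simp add: word_weight_def mult_le_one)
  qed (simp add: word_weight_def)
  obtain i v where w: "w = i # v" using assms(2) by (cases w) auto
  have "p i * word_weight p v \<le> p i" using *[of v] assms(1) w by (simp add: mult_left_le)
  moreover have "0 \<le> word_weight p w" using *[of w] assms(1) by blast
  ultimately show ?thesis using assms(1)[of i] w by (simp add: word_weight_def)
qed

context random_words
begin

abbreviation rep_weight :: "real list set \<Rightarrow> real" where
  "rep_weight c \<equiv> word_weight p (rep c)"

abbreviation occ :: "nat \<Rightarrow> 'a \<Rightarrow> real list set \<Rightarrow> nat" where
  "occ n \<omega> c \<equiv> cycle_count n (\<lambda>j. G n j \<omega>) (rep c)"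

lemma rep_weight_bounds:
  assumes "c \<in> primitive_classes_upto I k"
  shows "0 \<le> rep_weight c" "rep_weight c < 1"
  using word_weight_bounds[of "rep c" p] primitive_classes_upto_cases[OF assms] p_nonneg p_less_1
  by (auto simp: primitive_def subset_iff)

lemma sets_occ:
  assumes "n \<ge> 1"
  shows "{\<omega> \<in> space (M n). P (occ n \<omega> c)} \<in> sets (M n)"
  using measurable_sets[OF cycle_count_measurable[OF assms, of P "rep c"], of "{True}"]
  by (simp add: vimage_def Int_def conj_commute)

text \<open>Only one cycle of length at most \<open>k\<close> is prescribed, so the exact formula
  holds for all \<open>n > k\<close> at once; this is the source of the uniformity in
  \<open>n\<close>.\<close>

lemma prob_occ_pos:
  assumes "c \<in> primitive_classes_upto I k" "n > k"
  shows "measure (M n) {\<omega> \<in> space (M n). occ n \<omega> c \<noteq> 0} = rep_weight c"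
  using prob_cycle_count_ge[where A = "{c}" and k = k and n = n and m = "\<lambda>_. 1"] assms
    primitive_classes_upto_cases(3)[OF assms(1)]
  by (simp add: Suc_le_eq)

text \<open>A word of length \<open>k + 1\<close> contains at most \<open>k + 1\<close> different cycles, and each of length at
  most \<open>k\<close> occurs with probability equal to its weight.\<close>

lemma rep_weight_summable: "rep_weight summable_on primitive_classes_upto I k"
proof (rule nonneg_bdd_above_summable_on)
  interpret prob_space "M (Suc k)" by (rule prob_space_M) simp
  show "bdd_above (sum rep_weight ` {A. A \<subseteq> primitive_classes_upto I k \<and> finite A})"
  proof (rule bdd_aboveI2)
    fix A assume "A \<in> {A. A \<subseteq> primitive_classes_upto I k \<and> finite A}"
    then have A: "A \<subseteq> primitive_classes_upto I k" "finite A" by auto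
    let ?X = "\<lambda>c. {\<omega> \<in> space (M (Suc k)). occ (Suc k) \<omega> c \<noteq> 0}"
    have X: "?X c \<in> events" for c by (rule sets_occ) simp
    have "sum rep_weight A = (\<Sum>c\<in>A. prob (?X c))"
      using A(1) by (intro sum.cong refl prob_occ_pos[symmetric]) auto
    also have "\<dots> = (\<integral>\<omega>. (\<Sum>c\<in>A. indicator (?X c) \<omega>) \<partial>M (Suc k))"
      using X by (subst Bochner_Integration.integral_sum) (auto simp: emeasure_eq_measure)
    also have "\<dots> \<le> real (Suc k)"
    proof (rule integral_le_const)
      show "integrable (M (Suc k)) (\<lambda>\<omega>. \<Sum>c\<in>A. indicator (?X c) \<omega> :: real)"
        using X by (intro Bochner_Integration.integrable_sum) (auto simp: emeasure_eq_measure)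
      have "(\<Sum>c\<in>A. indicator (?X c) \<omega>) \<le> real (Suc k)" for \<omega>
      proof -
        have "(\<Sum>c\<in>A. indicator (?X c) \<omega>) \<le> (\<Sum>c\<in>A. real (occ (Suc k) \<omega> c))"
          by (intro sum_mono) (auto simp: indicator_def)
        also have "\<dots> = real (\<Sum>c\<in>A. occ (Suc k) \<omega> c)" by simp
        also have "\<dots> \<le> real (Suc k)"
          by (subst of_nat_le_iff) (rule sum_cycle_count_le[OF A(2,1)])
        finally show ?thesis .
      qed
      then show "AE \<omega> in M (Suc k). (\<Sum>c\<in>A. indicator (?X c) \<omega>) \<le> real (Suc k)" by simp
    qed
    finally show "sum rep_weight A \<le> real (Suc k)" .
  qed
qed (rule rep_weight_bounds)

text \<open>An equality is the difference of two tails: \<open>D = m\<close> is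
  \<open>D \<ge> m\<close> without \<open>D \<ge> m + 1\<close>. The classes are treated one at a
  time, and the mixed form, inequalities on \<open>A\<close> and equalities on \<open>B\<close>, is
  what the induction on \<open>B\<close> needs.\<close>

lemma prob_occ_ge_eq_tendsto:
  assumes "finite B" "finite A" "A \<inter> B = {}" "A \<union> B \<subseteq> primitive_classes_upto I k"
  shows "(\<lambda>n. measure (M n) {\<omega> \<in> space (M n). (\<forall>c\<in>A. m c \<le> occ n \<omega> c) \<and> (\<forall>c\<in>B. occ n \<omega> c = m c)})
    \<longlonglongrightarrow> (\<Prod>c\<in>A. rep_weight c ^ m c) * (\<Prod>c\<in>B. (1 - rep_weight c) * rep_weight c ^ m c)"
  using assms
proof (induction B arbitrary: A m rule: finite_induct)
  case empty
  have "eventually (\<lambda>n. n > (\<Sum>c\<in>A. m c * length (rep c))) sequentially" by (rule eventually_gt_at_top)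
  then have "eventually (\<lambda>n. measure (M n) {\<omega> \<in> space (M n). \<forall>c\<in>A. m c \<le> occ n \<omega> c} =
      (\<Prod>c\<in>A. rep_weight c ^ m c)) sequentially"
  proof (rule eventually_mono)
    fix n assume "n > (\<Sum>c\<in>A. m c * length (rep c))"
    then show "measure (M n) {\<omega> \<in> space (M n). \<forall>c\<in>A. m c \<le> occ n \<omega> c} = (\<Prod>c\<in>A. rep_weight c ^ m c)"
      using empty by (intro prob_cycle_count_ge) auto
  qed
  then show ?case by (auto intro: tendsto_eventually)
next
  case (insert b B)
  define m' where "m' = m(b := Suc (m b))"
  let ?E = "\<lambda>A B m n. {\<omega> \<in> space (M n). (\<forall>c\<in>A. m c \<le> occ n \<omega> c) \<and> (\<forall>c\<in>B. occ n \<omega> c = m c)}"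
  let ?r = "\<lambda>c. rep_weight c ^ m c" and ?s = "\<lambda>c. (1 - rep_weight c) * rep_weight c ^ m c"
  have b: "b \<notin> A" "b \<notin> B" using insert.prems insert.hyps by auto
  have m': "m' c = m c" if "c \<in> A \<union> B" for c using that b by (auto simp: m'_def)
  have E_sets: "?E A B m n \<in> sets (M n)" if "n \<ge> 1" "finite A" "finite B" for A B m n
    using that sets_occ[OF that(1)] by (intro sets.sets_Collect_conj sets.sets_Collect_finite_All)
  have fin: "finite (insert b A)" "insert b A \<inter> B = {}"
    "insert b A \<union> B \<subseteq> primitive_classes_upto I k"
    using insert.prems insert.hyps by auto
  have "(\<lambda>n. measure (M n) (?E (insert b A) B m n)) \<longlonglongrightarrow> (\<Prod>c\<in>insert b A. ?r c) * (\<Prod>c\<in>B. ?s c)"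
    using fin by (rule insert.IH)
  moreover have "(\<lambda>n. measure (M n) (?E (insert b A) B m' n)) \<longlonglongrightarrow>
      (\<Prod>c\<in>insert b A. rep_weight c ^ m' c) * (\<Prod>c\<in>B. (1 - rep_weight c) * rep_weight c ^ m' c)"
    using fin by (rule insert.IH)
  ultimately have "(\<lambda>n. measure (M n) (?E (insert b A) B m n) - measure (M n) (?E (insert b A) B m' n)) \<longlonglongrightarrow>
      (\<Prod>c\<in>insert b A. ?r c) * (\<Prod>c\<in>B. ?s c) -
      (\<Prod>c\<in>insert b A. rep_weight c ^ m' c) * (\<Prod>c\<in>B. (1 - rep_weight c) * rep_weight c ^ m' c)"
    by (rule tendsto_diff)
  also have "(\<Prod>c\<in>B. (1 - rep_weight c) * rep_weight c ^ m' c) = (\<Prod>c\<in>B. ?s c)"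
    by (rule prod.cong) (simp_all add: m')
  also have "(\<Prod>c\<in>insert b A. rep_weight c ^ m' c) = rep_weight b * (\<Prod>c\<in>insert b A. ?r c)"
  proof -
    have "(\<Prod>c\<in>A. rep_weight c ^ m' c) = (\<Prod>c\<in>A. ?r c)" by (rule prod.cong) (simp_all add: m')
    then show ?thesis using insert.prems(1) b by (simp add: m'_def)
  qed
  \<comment> \<open>The factor for \<open>b\<close> becomes
    \<open>rep_weight b ^ m b - rep_weight b * rep_weight b ^ m b\<close>, the geometric point
    mass.\<close>
  also have "(\<Prod>c\<in>insert b A. ?r c) * (\<Prod>c\<in>B. ?s c) - rep_weight b * (\<Prod>c\<in>insert b A. ?r c) * (\<Prod>c\<in>B. ?s c) =
      (\<Prod>c\<in>A. ?r c) * (\<Prod>c\<in>insert b B. ?s c)"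
    using insert.prems(1) insert.hyps b by (simp add: algebra_simps)
  finally have lim: "(\<lambda>n. measure (M n) (?E (insert b A) B m n) - measure (M n) (?E (insert b A) B m' n))
      \<longlonglongrightarrow> (\<Prod>c\<in>A. ?r c) * (\<Prod>c\<in>insert b B. ?s c)" .
  have "measure (M n) (?E (insert b A) B m n) - measure (M n) (?E (insert b A) B m' n) =
      measure (M n) (?E A (insert b B) m n)" if "n \<ge> 1" for n
  proof -
    interpret prob_space "M n" using that by (rule prob_space_M)
    have "?E (insert b A) B m' n = {\<omega> \<in> space (M n). Suc (m b) \<le> occ n \<omega> b \<and>
        (\<forall>c\<in>A. m c \<le> occ n \<omega> c) \<and> (\<forall>c\<in>B. occ n \<omega> c = m c)}"
      using m' by (auto simp: m'_def)
    then have "?E (insert b A) B m' n \<subseteq> ?E (insert b A) B m n"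
      "?E (insert b A) B m n - ?E (insert b A) B m' n = ?E A (insert b B) m n" by auto
    then show ?thesis
      using finite_measure_Diff[of "?E (insert b A) B m n" "?E (insert b A) B m' n"]
        E_sets[OF that fin(1) insert.hyps(1)] by simp
  qed
  then have "eventually (\<lambda>n. measure (M n) (?E (insert b A) B m n) - measure (M n) (?E (insert b A) B m' n) =
      measure (M n) (?E A (insert b B) m n)) sequentially"
    unfolding eventually_sequentially by blast
  from Lim_transform_eventually[OF lim this] show ?case .
qed

section \<open>The limit law\<close>

lemma sets_product_geometric:
  "sets (product_geometric I p k) = sets (real_PiM (primitive_classes_upto I k))"
  unfolding product_geometric_def by (intro sets_PiM_cong) auto

lemma product_prob_space_geometric:
  "product_prob_space (\<lambda>c. distr (measure_pmf (geometric_pmf (1 - word_weight p (rep c)))) borel real)"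
  by (intro product_prob_spaceI measure_pmf.prob_space_distr) simp

lemma measure_geometric:
  assumes "0 \<le> r" "r < 1"
  shows "measure (distr (measure_pmf (geometric_pmf (1 - r))) borel real) {real j} = (1 - r) * r ^ j"
proof -
  have "real -` {real j} = {j}" by auto
  then show ?thesis using assms by (simp add: measure_distr measure_pmf_single)
qed

lemma measure_product_geometric:
  assumes "finite A" "A \<subseteq> primitive_classes_upto I k"
  shows "measure (product_geometric I p k) {x \<in> space (product_geometric I p k). \<forall>c\<in>A. x c = real (m c)} =
    (\<Prod>c\<in>A. (1 - rep_weight c) * rep_weight c ^ m c)"
proof -
  interpret P: product_prob_space
    "\<lambda>c. distr (measure_pmf (geometric_pmf (1 - word_weight p (rep c)))) borel real"
    "primitive_classes_upto I k"
    by (rule product_prob_space_geometric)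
  have "emeasure (product_geometric I p k) {x \<in> space (product_geometric I p k). \<forall>c\<in>A. x c \<in> {real (m c)}} =
      (\<Prod>c\<in>A. emeasure (distr (measure_pmf (geometric_pmf (1 - rep_weight c))) borel real) {real (m c)})"
    unfolding product_geometric_def using assms by (intro P.emeasure_PiM_Collect) auto
  also have "\<dots> = (\<Prod>c\<in>A. ennreal ((1 - rep_weight c) * rep_weight c ^ m c))"
    using assms(2) rep_weight_bounds
    by (intro prod.cong refl) (auto simp: P.M.emeasure_eq_measure measure_geometric subset_iff)
  also have "\<dots> = ennreal (\<Prod>c\<in>A. (1 - rep_weight c) * rep_weight c ^ m c)"
    using assms(2) rep_weight_bounds by (intro prod_ennreal) (auto simp: subset_iff less_imp_le)
  finally have "emeasure (product_geometric I p k) {x \<in> space (product_geometric I p k). \<forall>c\<in>A. x c = real (m c)} =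
      ennreal (\<Prod>c\<in>A. (1 - rep_weight c) * rep_weight c ^ m c)" by simp
  moreover have "0 \<le> (1 - rep_weight c) * rep_weight c ^ m c" if "c \<in> A" for c
    using that assms(2) rep_weight_bounds[of c k] by auto
  ultimately show ?thesis by (simp add: measure_def prod_nonneg)
qed

lemma prob_space_product_geometric: "prob_space (product_geometric I p k)"
  unfolding product_geometric_def by (rule prob_space_PiM) (rule measure_pmf.prob_space_distr, simp)

lemma product_geometric_component_measurable:
  "c \<in> primitive_classes_upto I k \<Longrightarrow> (\<lambda>x. x c) \<in> borel_measurable (product_geometric I p k)"
  unfolding measurable_cong_sets[OF sets_product_geometric refl] by (rule measurable_component_singleton)

lemma product_geometric_nonzero:
  assumes "c \<in> primitive_classes_upto I k"
  shows "measure (product_geometric I p k) {x \<in> space (product_geometric I p k). x c \<noteq> 0} = rep_weight c"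
proof -
  interpret prob_space "product_geometric I p k" by (rule prob_space_product_geometric)
  note [measurable] = product_geometric_component_measurable[OF assms]
  have "prob {x \<in> space (product_geometric I p k). x c = 0} = 1 - rep_weight c"
    using measure_product_geometric[of "{c}" k "\<lambda>_. 0"] assms by simp
  moreover have "prob {x \<in> space (product_geometric I p k). x c \<noteq> 0} =
      1 - prob {x \<in> space (product_geometric I p k). x c = 0}"
    by (rule prob_neg) measurable
  ultimately show ?thesis by simp
qed

lemma product_geometric_AE_Nats:
  assumes "c \<in> primitive_classes_upto I k"
  shows "AE x in product_geometric I p k. x c \<in> \<nat>"
proof -
  interpret P: product_prob_space
    "\<lambda>c. distr (measure_pmf (geometric_pmf (1 - word_weight p (rep c)))) borel real"
    "primitive_classes_upto I k"
    by (rule product_prob_space_geometric)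
  have N: "\<nat> \<in> sets (borel :: real measure)" by (rule sets.countable) (auto simp: Nats_def)
  have "AE y in distr (measure_pmf (geometric_pmf (1 - rep_weight c))) borel real. y \<in> \<nat>"
    using N by (subst AE_distr_iff) (auto simp: Collect_mem_eq)
  then have "AE y in distr (product_geometric I p k)
      (distr (measure_pmf (geometric_pmf (1 - rep_weight c))) borel real) (\<lambda>x. x c). y \<in> \<nat>"
    unfolding product_geometric_def P.PiM_component[OF assms] .
  then show ?thesis
    by (rule AE_distrD[rotated]) (simp add: product_geometric_component_measurable[OF assms])
qed

text \<open>Almost surely all coordinates are natural numbers, and outside a finite \<open>A\<close>
  they all vanish except with probability at most the tail sum of the weights, which is arbitrarily
  small.\<close>

lemma measure_fin_supp_Nats:
  "measure (product_geometric I p k) (fin_supp (primitive_classes_upto I k) \<nat>) = 1"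
proof -
  let ?S = "primitive_classes_upto I k" and ?\<nu> = "product_geometric I p k"
  interpret prob_space ?\<nu> by (rule prob_space_product_geometric)
  have S: "countable ?S" using countable_I by (rule countable_primitive_classes_upto)
  have sp: "space ?\<nu> = ?S \<rightarrow>\<^sub>E UNIV"
    using sets_eq_imp_space_eq[OF sets_product_geometric[of k]] by (simp add: space_PiM)
  have F: "fin_supp ?S \<nat> \<in> events"
    unfolding sets_product_geometric
    using S singleton_in_sets_PiM[OF S]
    by (intro sets.countable[OF _ countable_fin_supp]) (auto simp: fin_supp_def Nats_def PiE_def)
  have "1 - measure ?\<nu> (fin_supp ?S \<nat>) \<le> e" if "e > 0" for e
  proof -
    obtain A where A: "finite A" "A \<subseteq> ?S"
      and small: "\<And>B. finite B \<Longrightarrow> A \<subseteq> B \<Longrightarrow> B \<subseteq> ?S \<Longrightarrow> \<bar>infsum rep_weight (?S - B)\<bar> < e"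
      by (rule infsum_outside_finite_small[OF rep_weight_summable \<open>e > 0\<close>]) (rule that)
    let ?U = "\<Union>c\<in>?S - A. {x \<in> space ?\<nu>. x c \<noteq> 0}"
    have nz: "{x \<in> space ?\<nu>. x c \<noteq> 0} \<in> events" if "c \<in> ?S - A" for c
    proof -
      have [measurable]: "(\<lambda>x. x c) \<in> borel_measurable ?\<nu>"
        using that by (intro product_geometric_component_measurable) simp
      show ?thesis by measurable
    qed
    have U: "?U \<in> events" using nz S by (intro sets.countable_UN') auto
    have "AE x in ?\<nu>. \<forall>c\<in>?S. x c \<in> \<nat>"
      using product_geometric_AE_Nats S by (intro AE_ball_countable') auto
    then have "AE x in ?\<nu>. x \<in> space ?\<nu> \<longrightarrow> x \<in> fin_supp ?S \<nat> \<union> ?U"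
    proof (rule AE_mp, intro AE_I2 impI)
      fix x assume x: "x \<in> space ?\<nu>" "\<forall>c\<in>?S. x c \<in> \<nat>"
      show "x \<in> fin_supp ?S \<nat> \<union> ?U"
      proof (cases "x \<in> ?U")
        case False
        then have "{c \<in> ?S. x c \<noteq> 0} \<subseteq> A" using x(1) by auto
        then have "finite {c \<in> ?S. x c \<noteq> 0}" using A(1) by (rule finite_subset)
        then show ?thesis using x by (auto simp: fin_supp_def sp PiE_iff)
      qed simp
    qed
    then have "prob (space ?\<nu>) \<le> prob (fin_supp ?S \<nat> \<union> ?U)"
      using F U by (intro finite_measure_mono_AE) auto
    also have "\<dots> \<le> prob (fin_supp ?S \<nat>) + prob ?U"
      using F U by (rule measure_Un_le)
    also have "prob ?U \<le> infsum rep_weight (?S - A)"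
    proof (rule measure_UN_le_infsum[OF _ nz])
      show "rep_weight summable_on ?S - A"
        by (rule summable_on_subset_banach[OF rep_weight_summable]) auto
    qed (use S in \<open>auto simp: product_geometric_nonzero\<close>)
    finally show ?thesis using small[OF A(1) order_refl A(2)] by (simp add: prob_space)
  qed
  then have "1 - measure ?\<nu> (fin_supp ?S \<nat>) \<le> 0" by (rule field_le_epsilon[where y = 0, simplified])
  then show ?thesis using prob_le_1[of "fin_supp ?S \<nat>"] by simp
qed

section \<open>The law of the cycle counts\<close>

lemma cycle_family_fin_supp: "cycle_family I k n g \<in> fin_supp (primitive_classes_upto I k) \<nat>"
proof -
  have "{c \<in> primitive_classes_upto I k. cycle_family I k n g c \<noteq> 0} =
      {c \<in> primitive_classes_upto I k. cycle_count n g (rep c) \<noteq> 0}"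
    by (auto simp: cycle_family_def)
  then show ?thesis using finite_cycle_count[of I k n g] by (auto simp: fin_supp_def cycle_family_def)
qed

lemma cycle_family_measurable:
  assumes "n \<ge> 1"
  shows "(\<lambda>\<omega>. cycle_family I k n (\<lambda>j. G n j \<omega>)) \<in> M n \<rightarrow>\<^sub>M real_PiM (primitive_classes_upto I k)"
  unfolding cycle_family_def
proof (rule measurable_restrict)
  fix c
  have "(\<lambda>\<omega>. real (occ n \<omega> c)) \<in> M n \<rightarrow>\<^sub>M count_space UNIV"
    by (rule cycle_count_measurable[OF assms])
  then show "(\<lambda>\<omega>. real (occ n \<omega> c)) \<in> borel_measurable (M n)"
    by (rule measurable_compose) simp
qed

text \<open>Three errors below \<open>e / 3\<close> add up: passing from the point mass to the event
  on a finite set \<open>A\<close>, once for the limit law and once for the law at \<open>n\<close>,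
  and the convergence of the probabilities of this event.\<close>

lemma cycle_family_point_mass:
  assumes x: "x \<in> fin_supp (primitive_classes_upto I k) \<nat>"
  shows "(\<lambda>n. measure (distr (M n) (real_PiM (primitive_classes_upto I k))
      (\<lambda>\<omega>. cycle_family I k n (\<lambda>j. G n j \<omega>))) {x}) \<longlonglongrightarrow> measure (product_geometric I p k) {x}"
proof (rule tendstoI)
  fix e :: real assume "e > 0"
  let ?S = "primitive_classes_upto I k" and ?\<nu> = "product_geometric I p k"
  let ?Y = "\<lambda>n \<omega>. cycle_family I k n (\<lambda>j. G n j \<omega>)"
  let ?\<mu> = "\<lambda>n. distr (M n) (real_PiM ?S) (?Y n)"
  have S: "countable ?S" using countable_I by (rule countable_primitive_classes_upto)
  have ext: "x \<in> extensional ?S" and fin: "finite {c \<in> ?S. x c \<noteq> 0}" and nat: "\<And>c. c \<in> ?S \<Longrightarrow> x c \<in> \<nat>"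
    using x by (auto simp: fin_supp_def PiE_def)
  define m where "m c = nat \<lfloor>x c\<rfloor>" for c
  have m: "x c = real (m c)" if "c \<in> ?S" for c
    using nat[OF that] by (auto simp: m_def Nats_def)
  have "e / 3 > 0" using \<open>e > 0\<close> by simp
  obtain A0 where A0: "finite A0" "A0 \<subseteq> ?S"
    and small: "\<And>B. finite B \<Longrightarrow> A0 \<subseteq> B \<Longrightarrow> B \<subseteq> ?S \<Longrightarrow> \<bar>infsum rep_weight (?S - B)\<bar> < e / 3"
    by (rule infsum_outside_finite_small[OF rep_weight_summable \<open>e / 3 > 0\<close>]) (rule that)
  \<comment> \<open>\<open>A0\<close> makes the tail sum small; the support of \<open>x\<close> is
    added so that \<open>x\<close> vanishes outside \<open>A\<close>, as
    \<open>point_mass_approx\<close> requires.\<close>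
  define A where "A = A0 \<union> {c \<in> ?S. x c \<noteq> 0}"
  have A: "finite A" "A \<subseteq> ?S" "\<And>c. c \<in> ?S - A \<Longrightarrow> x c = 0"
    unfolding A_def using A0 fin by (simp, simp, simp)
  have "A0 \<subseteq> A" by (simp add: A_def)
  with small[OF A(1) _ A(2)] have small: "infsum rep_weight (?S - A) < e / 3" by linarith
  have \<nu>: "\<bar>measure ?\<nu> {y \<in> space ?\<nu>. \<forall>c\<in>A. y c = x c} - measure ?\<nu> {x}\<bar> \<le> infsum rep_weight (?S - A)"
    by (rule point_mass_approx[OF prob_space_product_geometric sets_product_geometric S ext
          A(2,1,3) _ rep_weight_summable]) (simp_all add: product_geometric_nonzero)
  have "{y \<in> space ?\<nu>. \<forall>c\<in>A. y c = x c} = {y \<in> space ?\<nu>. \<forall>c\<in>A. y c = real (m c)}"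
    using m A(2) by (auto simp: subset_iff)
  then have \<nu>A: "measure ?\<nu> {y \<in> space ?\<nu>. \<forall>c\<in>A. y c = x c} = (\<Prod>c\<in>A. (1 - rep_weight c) * rep_weight c ^ m c)"
    using measure_product_geometric[OF A(1,2)] by simp
  have "(\<lambda>n. measure (M n) {\<omega> \<in> space (M n). \<forall>c\<in>A. occ n \<omega> c = m c}) \<longlonglongrightarrow>
      (\<Prod>c\<in>A. (1 - rep_weight c) * rep_weight c ^ m c)"
    using prob_occ_ge_eq_tendsto[of A "{}" k m] A by simp
  then have "eventually (\<lambda>n. dist (measure (M n) {\<omega> \<in> space (M n). \<forall>c\<in>A. occ n \<omega> c = m c})
      (\<Prod>c\<in>A. (1 - rep_weight c) * rep_weight c ^ m c) < e / 3) sequentially"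
    using \<open>e / 3 > 0\<close> by (rule tendstoD)
  \<comment> \<open>For \<open>n > k\<close> each class occurs with probability exactly
    \<open>rep_weight c\<close>, so the law at \<open>n\<close> has the same tail bound as the
    limit.\<close>
  moreover have "eventually (\<lambda>n. n > k) sequentially" by (rule eventually_gt_at_top)
  ultimately show "eventually (\<lambda>n. dist (measure (?\<mu> n) {x}) (measure ?\<nu> {x}) < e) sequentially"
  proof eventually_elim
    case (elim n)
    have "n \<ge> 1" using elim(2) by simp
    interpret prob_space "M n" using \<open>n \<ge> 1\<close> by (rule prob_space_M)
    note meas = cycle_family_measurable[OF \<open>n \<ge> 1\<close>, of k]
    have distr: "measure (?\<mu> n) {y \<in> space (?\<mu> n). P y} = prob {\<omega> \<in> space (M n). P (?Y n \<omega>)}"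
      if "{y \<in> space (real_PiM ?S). P y} \<in> sets (real_PiM ?S)" for P
    proof -
      have "?Y n -` {y \<in> space (real_PiM ?S). P y} \<inter> space (M n) = {\<omega> \<in> space (M n). P (?Y n \<omega>)}"
        using measurable_space[OF meas] by blast
      with measure_distr[OF meas that] show ?thesis by (simp only: space_distr)
    qed
    have coord: "{y \<in> space (real_PiM ?S). Q (y c)} \<in> sets (real_PiM ?S)"
      if "c \<in> ?S" "{z. Q z} \<in> sets borel" for c and Q :: "real \<Rightarrow> bool"
      using measurable_sets[OF measurable_component_singleton[OF that(1), of "\<lambda>_. borel"] that(2)]
      by (simp add: vimage_def Int_def conj_commute)
    have nz: "measure (?\<mu> n) {y \<in> space (?\<mu> n). y c \<noteq> 0} = rep_weight c" if c: "c \<in> ?S" for c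
    proof -
      have "{y \<in> space (real_PiM ?S). y c \<noteq> 0} \<in> sets (real_PiM ?S)"
        using c by (rule coord) (simp add: Collect_neg_eq)
      from distr[OF this] show ?thesis
        using prob_occ_pos[OF c elim(2)] c by (simp add: cycle_family_def)
    qed
    have "\<bar>measure (?\<mu> n) {y \<in> space (?\<mu> n). \<forall>c\<in>A. y c = x c} - measure (?\<mu> n) {x}\<bar> \<le>
        infsum rep_weight (?S - A)"
    proof (rule point_mass_approx[OF _ _ S ext A(2,1,3) _ rep_weight_summable])
      show "prob_space (?\<mu> n)" using meas by (rule prob_space_distr)
    qed (simp_all add: nz del: space_distr)
    moreover have "measure (?\<mu> n) {y \<in> space (?\<mu> n). \<forall>c\<in>A. y c = x c} =
        prob {\<omega> \<in> space (M n). \<forall>c\<in>A. occ n \<omega> c = m c}"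
    proof -
      have "{y \<in> space (real_PiM ?S). y c = x c} \<in> sets (real_PiM ?S)" if "c \<in> A" for c
        using that A(2) by (intro coord) auto
      then have "{y \<in> space (real_PiM ?S). \<forall>c\<in>A. y c = x c} \<in> sets (real_PiM ?S)"
        using A(1) by (rule sets.sets_Collect_finite_All)
      from distr[OF this] show ?thesis
      proof (rule trans, intro arg_cong[where f = prob] Collect_cong conj_cong refl ball_cong)
        fix \<omega> c assume "c \<in> A"
        then have "c \<in> ?S" using A(2) by blast
        then show "(?Y n \<omega> c = x c) = (occ n \<omega> c = m c)" using m by (simp add: cycle_family_def)
      qed
    qed
    ultimately show ?case
      using \<nu> \<nu>A small elim(1) unfolding dist_real_def by linarith
  qed
qed

end

theorem theorem1p2:
  fixes I :: "real set" and p :: "real \<Rightarrow> real" and k :: nat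
    and M :: "nat \<Rightarrow> 'a measure" and G :: "nat \<Rightarrow> nat \<Rightarrow> 'a \<Rightarrow> real"
  assumes "countable I"
    and "\<And>i. i \<in> I \<Longrightarrow> 0 \<le> p i"
    and "(p has_sum 1) I"
    and "\<And>i. i \<in> I \<Longrightarrow> p i < 1"
    and "\<And>n. n \<ge> 1 \<Longrightarrow> prob_space (M n)"
    and "\<And>n. n \<ge> 1 \<Longrightarrow> prob_space.indep_vars (M n) (\<lambda>_. count_space I) (G n) {1..n}"
    and "\<And>n j i. n \<ge> 1 \<Longrightarrow> j \<in> {1..n} \<Longrightarrow> i \<in> I \<Longrightarrow>
           measure (M n) {\<omega> \<in> space (M n). G n j \<omega> = i} = p i"
    and "k \<ge> 1"
  shows "converges_in_distribution (ell1_topology (primitive_classes_upto I k)) M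
           (\<lambda>n \<omega>. cycle_family I k n (\<lambda>j. G n j \<omega>))
           (product_geometric_ell1 I p k)"
proof -
  interpret random_words I p M G
    by (rule random_words.intro) (fact assms)+
  let ?S = "primitive_classes_upto I k" and ?\<nu> = "product_geometric I p k"
  let ?N = "real_PiM ?S" and ?Y = "\<lambda>n \<omega>. cycle_family I k n (\<lambda>j. G n j \<omega>)"
  let ?B = "borel_of_topology (ell1_topology ?S)"
  have S: "countable ?S" using countable_I by (rule countable_primitive_classes_upto)
  interpret \<nu>: prob_space ?\<nu> by (rule prob_space_product_geometric)
  have E: "ell1 ?S \<in> sets ?N" using S by (rule ell1_measurable)
  then have E\<nu>: "ell1 ?S \<in> sets ?\<nu>" by (simp add: sets_product_geometric)
  have Y_E: "?Y n \<omega> \<in> ell1 ?S" for n \<omega>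
    using cycle_family_fin_supp fin_supp_subset_ell1 by blast
  have B: "sets ?B = sets (restrict_space ?N (ell1 ?S))" using S by (rule sets_borel_ell1)
  have Y_B: "?Y n \<in> measurable (M n) ?B" if "n \<ge> 1" for n
    unfolding measurable_cong_sets[OF refl B]
    using Y_E cycle_family_measurable[OF that] by (intro measurable_restrict_space2) auto
  have "\<nu>.prob (ell1 ?S) \<ge> \<nu>.prob (fin_supp ?S \<nat>)"
    using fin_supp_subset_ell1 E\<nu> by (rule \<nu>.finite_measure_mono)
  then have "\<nu>.prob (ell1 ?S) = 1"
    using measure_fin_supp_Nats \<nu>.prob_le_1[of "ell1 ?S"] by simp
  then have prob: "prob_space (product_geometric_ell1 I p k)"
    unfolding product_geometric_ell1_def
    using E\<nu> by (intro prob_space_restrict_space) (simp_all add: \<nu>.emeasure_eq_measure)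
  have sets: "sets (product_geometric_ell1 I p k) = sets ?B"
    unfolding B product_geometric_ell1_def
    by (rule sets_restrict_space_cong) (rule sets_product_geometric)
  have space: "space (product_geometric_ell1 I p k) = topspace (ell1_topology ?S)"
    using sets_eq_imp_space_eq[OF sets] by (simp add: borel_of_topology_simps)
  have "(\<lambda>n. \<integral>\<omega>. f (?Y n \<omega>) \<partial>M n) \<longlonglongrightarrow> (\<integral>x. f x \<partial>product_geometric_ell1 I p k)"
    if f: "continuous_map (ell1_topology ?S) euclideanreal f" "bounded (f ` topspace (ell1_topology ?S))" for f
  proof -
    \<comment> \<open>\<open>f\<close> is controlled only on \<open>ell1\<close>. Extended by 0 it
      becomes a bounded measurable function on the whole product space, where both laws can be
      compared.\<close>
    define h where "h x = indicator (ell1 ?S) x *\<^sub>R f x" for x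
    have "f \<in> borel_measurable ?B"
    proof (rule borel_measurableI)
      fix U :: "real set" assume "open U"
      then have "openin (ell1_topology ?S) {x \<in> topspace (ell1_topology ?S). f x \<in> U}"
        using f(1) by (intro openin_continuous_map_preimage) auto
      from borel_of_topology_simps(2)[OF this] show "f -` U \<inter> space ?B \<in> sets ?B"
        by (simp add: borel_of_topology_simps(1) vimage_def Int_def conj_commute)
    qed
    then have "f \<in> borel_measurable (restrict_space ?N (ell1 ?S))"
      using measurable_cong_sets[OF B refl] by blast
    then have h: "h \<in> borel_measurable ?N"
      unfolding h_def using E by (subst (asm) borel_measurable_restrict_space_iff) auto
    obtain C where C: "\<And>x. x \<in> ell1 ?S \<Longrightarrow> \<bar>f x\<bar> \<le> C"
      using f(2) by (auto simp: bounded_iff)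
    have bound: "\<bar>h x\<bar> \<le> max C 0" for x
      using C[of x] by (auto simp: h_def indicator_def)
    have "(\<lambda>n. \<integral>x. h x \<partial>distr (M n) ?N (?Y n)) \<longlonglongrightarrow> (\<integral>x. h x \<partial>?\<nu>)"
    \<comment> \<open>\<open>n0\<close> is 1 because \<open>M n\<close> is a probability space for
      \<open>n \<ge> 1\<close>; \<open>max C 0\<close> also covers the points off
      \<open>ell1\<close>, where \<open>h\<close> is 0.\<close>
    proof (rule integral_tendsto_discrete[where ?n0.0 = 1 and F = "fin_supp ?S \<nat>" and C = "max C 0"])
      show "prob_space (distr (M n) ?N (?Y n))" if "n \<ge> 1" for n
        using prob_space_M[OF that] cycle_family_measurable[OF that] by (rule prob_space.prob_space_distr)
      show "countable (fin_supp ?S \<nat>)"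
        using S by (rule countable_fin_supp) (simp add: Nats_def)
      show "{x} \<in> sets ?\<nu>" if "x \<in> fin_supp ?S \<nat>" for x
        unfolding sets_product_geometric
        using S that by (intro singleton_in_sets_PiM) (auto simp: fin_supp_def PiE_def)
      show "h \<in> borel_measurable ?\<nu>"
        using h measurable_cong_sets[OF sets_product_geometric refl] by blast
    qed (use prob_space_product_geometric measure_fin_supp_Nats cycle_family_point_mass bound
        in \<open>auto simp: sets_product_geometric\<close>)
    moreover have "(\<integral>x. h x \<partial>?\<nu>) = (\<integral>x. f x \<partial>product_geometric_ell1 I p k)"
      unfolding product_geometric_ell1_def h_def
      using E\<nu> by (intro integral_restrict_space[symmetric]) auto
    moreover have "(\<integral>x. h x \<partial>distr (M n) ?N (?Y n)) = (\<integral>\<omega>. f (?Y n \<omega>) \<partial>M n)" if "n \<ge> 1" for n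
      using Y_E by (subst integral_distr[OF cycle_family_measurable[OF that] h]) (simp add: h_def)
    then have "eventually (\<lambda>n. (\<integral>x. h x \<partial>distr (M n) ?N (?Y n)) = (\<integral>\<omega>. f (?Y n \<omega>) \<partial>M n)) sequentially"
      unfolding eventually_sequentially by blast
    ultimately show ?thesis using Lim_transform_eventually by fastforce
  qed
  then show ?thesis
    unfolding converges_in_distribution_def using assms(5) Y_B prob sets space by blast
qed

end
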